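(* Let $K$ be a commutative ring and $n\ge4$. 1. If $n$ is an odd number then the Jacobian ascents $$\Gamma=\Gamma_2\supset\Gamma_4\supset\cdots\supset\Gamma_{2s}\supset\cdots\supset\Gamma_{2[\frac n2]}\supset\Gamma_{2[\frac n2]+2}=\Sigma$$ are distinct groups. 2. If $n$ is an even number then the Jacobian ascents $$\Gamma=\Gamma_2\supset\Gamma_4\supset\cdots\supset\Gamma_{2s}\supset\cdots\supset\Gamma_{2[\frac n2]-2}\supset\Gamma_{2[\frac n2]}=\Gamma_{2[\frac n2]+2}=\Sigma$$ are distinct groups except the last two groups, i.e. $\Gamma_{2[\frac n2]}=\Gamma_{2[\frac n2]+2}$.
   Context: Rings are associative with $1$. $\Lambda_n=\Lambda_n(K)$ is the Grassmann $K$-algebra generated freely over $K$ by $x_1,\dots,x_n$ subject to $x_i^2=0$, $x_ix_j=-x_jx_i$ ($i\ne j$); it is graded by total degree with components $\Lambda_{n,d}$; $\mathfrak m=\bigoplus_{d\ge1}\Lambda_{n,d}$; $\Lambda_n^{od}$ is the sum of the odd degree components. $\Gamma$ is the group of $K$-algebra automorphisms $\sigma$ of $\Lambda_n$ with $\sigma(x_i)-x_i\in\Lambda_n^{od}\cap\mathfrak m^3$ for all $i$. The left skew derivation $\partial/\partial x_j$ is the $K$-linear map with $\frac{\partial x_k}{\partial x_j}=\delta_{jk}$ and $\frac{\partial (ab)}{\partial x_j}=\frac{\partial a}{\partial x_j}b+(-1)^i a\frac{\partial b}{\partial x_j}$ for $a\in\Lambda_{n,i}$. For $\sigma\in\Gamma$,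 $\mathcal J(\sigma)=\det(\partial\sigma(x_i)/\partial x_j)$ (entries are even, hence central). $E'_{n,2m}=(1+\sum_{i\ge1}\Lambda_{n,2i})\cap(1+\mathfrak m^{2m})$. The Jacobian group is $\Sigma=\{\sigma\in\Gamma\mid\mathcal J(\sigma)=1\}$, and the Jacobian ascents are the subgroups $\Gamma_{2m}=\{\sigma\in\Gamma\mid\mathcal J(\sigma)\in E'_{n,2m}\}$ of $\Gamma$, $m=1,\dots,[\frac n2]+1$. $[\cdot]$ is the integer part. *)

theory Defs
  imports Complex_Main "HOL-Library.Poly_Mapping" "HOL-Combinatorics.Permutations" "HOL-Algebra.Group"
begin

section \<open>The Grassmann algebra by generators and relations\<close>

text \<open>Words under concatenation, written additively so that
  \<^typ>\<open>'n list \<Rightarrow>\<^sub>0 'k\<close>, with the convolution product of Poly_Mapping,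
  is the free associative \<open>'k\<close>-algebra on the letters \<open>'n\<close>.\<close>

instantiation list :: (type) monoid_add
begin
definition zero_list :: "'a list" where "zero_list = []"
definition plus_list :: "'a list \<Rightarrow> 'a list \<Rightarrow> 'a list" where "plus_list = (@)"
instance by standard (simp_all add: zero_list_def plus_list_def)
end

abbreviation word :: "'n list \<Rightarrow> 'n list \<Rightarrow>\<^sub>0 'k::comm_ring_1" where
  "word w \<equiv> Poly_Mapping.single w 1"

text \<open>The two-sided ideal generated by the relations.\<close>

inductive_set grassmann_ideal :: "('n list \<Rightarrow>\<^sub>0 'k::comm_ring_1) set" where
  square: "word [i] * word [i] \<in> grassmann_ideal"
| anticommute: "i \<noteq> j \<Longrightarrow> word [i] * word [j] + word [j] * word [i] \<in> grassmann_ideal"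
| add: "p \<in> grassmann_ideal \<Longrightarrow> q \<in> grassmann_ideal \<Longrightarrow> p + q \<in> grassmann_ideal"
| mult_left: "p \<in> grassmann_ideal \<Longrightarrow> r * p \<in> grassmann_ideal"
| mult_right: "p \<in> grassmann_ideal \<Longrightarrow> p * r \<in> grassmann_ideal"

lemma grassmann_ideal_uminus: "p \<in> grassmann_ideal \<Longrightarrow> - p \<in> grassmann_ideal"
  using grassmann_ideal.mult_left[of p "-1"] by simp

lemma grassmann_ideal_zero: "0 \<in> grassmann_ideal"
  using grassmann_ideal.mult_left[OF grassmann_ideal.square, of 0] by simp

lemma lookup_mult_Nil:
  fixes p q :: "'n list \<Rightarrow>\<^sub>0 'k::comm_ring_1"
  shows "Poly_Mapping.lookup (p * q) [] = Poly_Mapping.lookup p [] * Poly_Mapping.lookup q []"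
proof -
  have "(Poly_Mapping.lookup q m when [] = l + m) =
      ((Poly_Mapping.lookup q [] when l = []) when m = [])" for l m :: "'n list"
    by (auto simp: plus_list_def when_def)
  then have "Poly_Mapping.lookup (p * q) [] =
      (\<Sum>l. Poly_Mapping.lookup p l * (Poly_Mapping.lookup q [] when l = []))"
    by (simp add: lookup_mult)
  then show ?thesis by (simp add: mult_when)
qed

lemma grassmann_ideal_lookup_Nil:
  "p \<in> grassmann_ideal \<Longrightarrow> Poly_Mapping.lookup p [] = 0"
  by (induction rule: grassmann_ideal.induct)
    (auto simp: lookup_mult_Nil lookup_add lookup_single)

definition grassmann_rel :: "('n list \<Rightarrow>\<^sub>0 'k::comm_ring_1) \<Rightarrow> ('n list \<Rightarrow>\<^sub>0 'k) \<Rightarrow> bool" where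
  "grassmann_rel p q \<longleftrightarrow> p - q \<in> grassmann_ideal"

text \<open>\<open>('k, 'n) grassmann\<close> is the Grassmann algebra over \<open>'k\<close> in \<open>card (UNIV :: 'n set)\<close> generators.\<close>

quotient_type (overloaded) ('k, 'n) grassmann = "'n list \<Rightarrow>\<^sub>0 'k::comm_ring_1" / grassmann_rel
proof (rule equivpI)
  show "reflp grassmann_rel"
    by (auto intro!: reflpI simp: grassmann_rel_def grassmann_ideal_zero)
  show "symp grassmann_rel"
    unfolding grassmann_rel_def by (rule sympI) (drule grassmann_ideal_uminus, simp)
  show "transp grassmann_rel"
    unfolding grassmann_rel_def by (rule transpI) (drule (1) grassmann_ideal.add, simp)
qed

instantiation grassmann :: (comm_ring_1, type) ring_1
begin

lift_definition zero_grassmann :: "('a, 'b) grassmann" is 0 .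
lift_definition one_grassmann :: "('a, 'b) grassmann" is 1 .

lift_definition plus_grassmann ::
  "('a, 'b) grassmann \<Rightarrow> ('a, 'b) grassmann \<Rightarrow> ('a, 'b) grassmann" is "(+)"
  unfolding grassmann_rel_def by (drule (1) grassmann_ideal.add) (simp add: algebra_simps)

lift_definition uminus_grassmann :: "('a, 'b) grassmann \<Rightarrow> ('a, 'b) grassmann" is uminus
  unfolding grassmann_rel_def by (drule grassmann_ideal_uminus) simp

lift_definition minus_grassmann ::
  "('a, 'b) grassmann \<Rightarrow> ('a, 'b) grassmann \<Rightarrow> ('a, 'b) grassmann" is "(-)"
proof -
  fix p p' q q' :: "'b list \<Rightarrow>\<^sub>0 'a"
  assume "grassmann_rel p p'" "grassmann_rel q q'"
  then have "(p - p') + - (q - q') \<in> grassmann_ideal"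
    unfolding grassmann_rel_def by (intro grassmann_ideal.add grassmann_ideal_uminus)
  then show "grassmann_rel (p - q) (p' - q')"
    unfolding grassmann_rel_def by (simp add: algebra_simps)
qed

lift_definition times_grassmann ::
  "('a, 'b) grassmann \<Rightarrow> ('a, 'b) grassmann \<Rightarrow> ('a, 'b) grassmann" is "(*)"
proof -
  fix p p' q q' :: "'b list \<Rightarrow>\<^sub>0 'a"
  assume "grassmann_rel p p'" "grassmann_rel q q'"
  then have "(p - p') * q + p' * (q - q') \<in> grassmann_ideal"
    unfolding grassmann_rel_def
    by (intro grassmann_ideal.add grassmann_ideal.mult_left grassmann_ideal.mult_right)
  then show "grassmann_rel (p * q) (p' * q')"
    unfolding grassmann_rel_def by (simp add: algebra_simps)
qed

instance
proof
  fix a b c :: "('a, 'b) grassmann"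
  have eqI: "grassmann_rel p q" if "p = q" for p q :: "'b list \<Rightarrow>\<^sub>0 'a"
    using that by (simp add: grassmann_rel_def grassmann_ideal_zero)
  show "a * b * c = a * (b * c)" by transfer (rule eqI, simp add: algebra_simps)
  show "1 * a = a" by transfer (rule eqI, simp)
  show "a * 1 = a" by transfer (rule eqI, simp)
  show "a + b + c = a + (b + c)" by transfer (rule eqI, simp add: algebra_simps)
  show "a + b = b + a" by transfer (rule eqI, simp add: algebra_simps)
  show "0 + a = a" by transfer (rule eqI, simp)
  show "- a + a = 0" by transfer (rule eqI, simp)
  show "a - b = a + - b" by transfer (rule eqI, simp)
  show "(a + b) * c = a * c + b * c" by transfer (rule eqI, simp add: algebra_simps)
  show "a * (b + c) = a * b + a * c" by transfer (rule eqI, simp add: algebra_simps)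
  show "(0 :: ('a, 'b) grassmann) \<noteq> 1"
  proof transfer
    show "\<not> grassmann_rel (0 :: 'b list \<Rightarrow>\<^sub>0 'a) 1"
    proof
      assume "grassmann_rel (0 :: 'b list \<Rightarrow>\<^sub>0 'a) 1"
      then have "Poly_Mapping.lookup (0 - 1 :: 'b list \<Rightarrow>\<^sub>0 'a) [] = 0"
        unfolding grassmann_rel_def by (rule grassmann_ideal_lookup_Nil)
      then show False
        by (simp add: lookup_minus lookup_one zero_list_def)
    qed
  qed
qed

end

lift_definition scale :: "'k::comm_ring_1 \<Rightarrow> ('k, 'n) grassmann \<Rightarrow> ('k, 'n) grassmann"
  is "\<lambda>c p. Poly_Mapping.single [] c * p"
  unfolding grassmann_rel_def
  by (simp add: grassmann_ideal.mult_left flip: right_diff_distrib)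

lift_definition gen :: "'n \<Rightarrow> ('k::comm_ring_1, 'n) grassmann" is "\<lambda>i. word [i]" .


section \<open>Grading and augmentation ideal\<close>

global_interpretation grassmann: module "scale :: 'k::comm_ring_1 \<Rightarrow> ('k, 'n) grassmann \<Rightarrow> _"
proof
  fix c d :: 'k and a b :: "('k, 'n) grassmann"
  have eqI: "grassmann_rel p q" if "p = q" for p q :: "'n list \<Rightarrow>\<^sub>0 'k"
    using that by (simp add: grassmann_rel_def grassmann_ideal_zero)
  show "scale c (a + b) = scale c a + scale c b"
    by transfer (rule eqI, simp add: algebra_simps)
  show "scale (c + d) a = scale c a + scale d a"
    by transfer (rule eqI, simp add: algebra_simps single_add)
  show "scale c (scale d a) = scale (c * d) a"
    by transfer (rule eqI, simp add: mult_single plus_list_def flip: mult.assoc)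
  show "scale 1 a = a"
    by transfer (rule eqI, simp flip: zero_list_def)
qed

abbreviation lspan :: "('k::comm_ring_1, 'n) grassmann set \<Rightarrow> ('k, 'n) grassmann set" where
  "lspan \<equiv> module.span scale"

definition component :: "nat \<Rightarrow> ('k::comm_ring_1, 'n) grassmann set" where
  "component d = lspan {prod_list (map gen w) | w. length w = d}"

definition components :: "nat set \<Rightarrow> ('k::comm_ring_1, 'n) grassmann set" where
  "components D = lspan (\<Union>d\<in>D. component d)"

fun max_ideal_power :: "nat \<Rightarrow> ('k::comm_ring_1, 'n) grassmann set" where
  "max_ideal_power 0 = UNIV"
| "max_ideal_power (Suc k) = lspan {a * b | a b. a \<in> components {1..} \<and> b \<in> max_ideal_power k}"


section \<open>Skew derivations, Jacobian and the groups\<close>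

definition is_skew_partial ::
  "'n \<Rightarrow> (('k::comm_ring_1, 'n) grassmann \<Rightarrow> ('k, 'n) grassmann) \<Rightarrow> bool" where
  "is_skew_partial j D \<longleftrightarrow>
     (\<forall>a b. D (a + b) = D a + D b) \<and> (\<forall>c a. D (scale c a) = scale c (D a)) \<and>
     (\<forall>k. D (gen k) = (if j = k then 1 else 0)) \<and>
     (\<forall>i. \<forall>a \<in> component i. \<forall>b. D (a * b) = D a * b + (-1) ^ i * a * D b)"

text \<open>Existence and uniqueness: the derivation of the free algebra determined by these rules
  maps the ideal of relations into itself, and the words span.\<close>

definition skew_partial ::
  "'n \<Rightarrow> ('k::comm_ring_1, 'n) grassmann \<Rightarrow> ('k, 'n) grassmann" where
  "skew_partial j = (THE D. is_skew_partial j D)"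

text \<open>The Leibniz expansion, with factors taken in increasing row order; the ring is not
  commutative, but this is only applied to matrices with central entries.\<close>

definition leibniz_det :: "('n::{finite,linorder} \<Rightarrow> 'n \<Rightarrow> 'r::ring_1) \<Rightarrow> 'r" where
  "leibniz_det A = (\<Sum>p | p permutes UNIV.
     of_int (sign p) * prod_list (map (\<lambda>i. A i (p i)) (sorted_list_of_set UNIV)))"

definition jacobian ::
  "(('k::comm_ring_1, 'n::{finite,linorder}) grassmann \<Rightarrow> ('k, 'n) grassmann) \<Rightarrow> ('k, 'n) grassmann" where
  "jacobian \<sigma> = leibniz_det (\<lambda>i j. skew_partial j (\<sigma> (gen i)))"

definition is_algebra_automorphism ::
  "(('k::comm_ring_1, 'n) grassmann \<Rightarrow> ('k, 'n) grassmann) \<Rightarrow> bool" where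
  "is_algebra_automorphism \<sigma> \<longleftrightarrow> bij \<sigma> \<and> \<sigma> 1 = 1 \<and>
     (\<forall>a b. \<sigma> (a + b) = \<sigma> a + \<sigma> b) \<and> (\<forall>a b. \<sigma> (a * b) = \<sigma> a * \<sigma> b) \<and>
     (\<forall>c a. \<sigma> (scale c a) = scale c (\<sigma> a))"

definition Gamma :: "(('k::comm_ring_1, 'n) grassmann \<Rightarrow> ('k, 'n) grassmann) set" where
  "Gamma = {\<sigma>. is_algebra_automorphism \<sigma> \<and>
     (\<forall>i. \<sigma> (gen i) - gen i \<in> components {d. odd d} \<inter> max_ideal_power 3)}"

definition Gamma_group :: "(('k::comm_ring_1, 'n) grassmann \<Rightarrow> ('k, 'n) grassmann) monoid" where
  "Gamma_group = \<lparr>carrier = Gamma, mult = (\<circ>), one = id\<rparr>"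

definition E' :: "nat \<Rightarrow> ('k::comm_ring_1, 'n) grassmann set" where
  "E' k = (+) 1 ` components {d. even d \<and> d \<ge> 2} \<inter> (+) 1 ` max_ideal_power k"

definition Jacobian_group ::
  "(('k::comm_ring_1, 'n::{finite,linorder}) grassmann \<Rightarrow> ('k, 'n) grassmann) set" where
  "Jacobian_group = {\<sigma> \<in> Gamma. jacobian \<sigma> = 1}"

text \<open>The argument is the index \<open>2m\<close> of \<open>\<Gamma>\<^sub>2\<^sub>m\<close>, not \<open>m\<close>.\<close>

definition Jacobian_ascent ::
  "nat \<Rightarrow> (('k::comm_ring_1, 'n::{finite,linorder}) grassmann \<Rightarrow> ('k, 'n) grassmann) set" where
  "Jacobian_ascent k = {\<sigma> \<in> Gamma. jacobian \<sigma> \<in> E' k}"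

end

theory Submission
  imports "HOL-Analysis.Determinants" Defs
begin

text \<open>
  The chain rule for skew derivations and \<open>det (A B) = det A det B\<close> over the commutative even part
  give the cocycle identity \<open>J(\<sigma> \<circ> \<tau>) = J(\<sigma>) \<sigma>(J(\<tau>))\<close>. As \<open>\<sigma> \<in> \<Gamma>\<close> and its inverse respect parity
  and the degree filtration, every ascent is a subgroup. The inclusions are strict
  because \<open>x\<^sub>k \<mapsto> x\<^sub>k + x\<^sub>k x\<^sub>S\<close> with \<open>k \<notin> S\<close>, \<open>|S| = 2m\<close>, has Jacobian \<open>1 + x\<^sub>S\<close>, which needs \<open>2m < n\<close>.
  For the equality of the last two groups when \<open>n\<close> is even, let \<open>top\<close> be the coefficient of \<open>x\<^sub>1 \<dots> x\<^sub>n\<close>.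
  Berezin's change of variables \<open>top (\<sigma>(f) J(\<sigma>)\<inverse>) = top f\<close> holds over every commutative ring: it is
  multiplicative in \<open>\<sigma>\<close>, each \<open>\<sigma> \<in> \<Gamma>\<close> is a product of automorphisms that move a single generator, and
  for those it is a direct computation. If \<open>J(\<sigma>) = 1 + c x\<^sub>1 \<dots> x\<^sub>n\<close>, taking \<open>f = 1\<close> yields \<open>c = 0\<close>.
\<close>

section \<open>Linear maps out of the Grassmann algebra\<close>

lemma poly_mapping_single_induct [case_names zero single add]:
  fixes p :: "'a \<Rightarrow>\<^sub>0 'b::comm_monoid_add"
  assumes "P 0" "\<And>k v. P (Poly_Mapping.single k v)" "\<And>f g. P f \<Longrightarrow> P g \<Longrightarrow> P (f + g)"
  shows "P p"
proof -
  have "P (\<Sum>k\<in>A. Poly_Mapping.single k (Poly_Mapping.lookup p k))" if "finite A" for A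
    using that by (induction A) (auto intro: assms)
  moreover have "p = (\<Sum>k\<in>Poly_Mapping.keys p. Poly_Mapping.single k (Poly_Mapping.lookup p k))"
    by (rule poly_mapping_eqI)
      (auto simp: lookup_sum lookup_single when_def in_keys_iff intro!: sum.neutral)
  ultimately show ?thesis by (metis finite_keys)
qed

abbreviation gword :: "'n list \<Rightarrow> ('k::comm_ring_1, 'n) grassmann" where
  "gword w \<equiv> prod_list (map gen w)"

text \<open>Scalars are supported on the empty word, the unit for concatenation, so they are central
  in the free algebra.\<close>

lemma single_Nil_commute:
  fixes p :: "'n list \<Rightarrow>\<^sub>0 'k::comm_ring_1"
  shows "Poly_Mapping.single [] c * p = p * Poly_Mapping.single [] c"
  by (induction p rule: poly_mapping_single_induct)
    (simp_all add: distrib_left distrib_right mult_single plus_list_def mult.commute)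

lemma grassmann_relI: "p = q \<Longrightarrow> grassmann_rel p q"
  by (simp add: grassmann_rel_def grassmann_ideal_zero)

lemma scale_mult_left: "scale c a * b = scale c (a * b)"
  by transfer (rule grassmann_relI, simp add: mult.assoc)

lemma scale_mult_right: "a * scale c b = scale c (a * b)"
  by transfer (rule grassmann_relI, metis mult.assoc single_Nil_commute)

lemma abs_rep_grassmann: "abs_grassmann (rep_grassmann a) = a"
  by (rule Quotient3_abs_rep[OF Quotient3_grassmann])

lemma rel_rep_abs_grassmann: "grassmann_rel (rep_grassmann (abs_grassmann p)) p"
  by (simp add: abs_rep_grassmann flip: grassmann.abs_eq_iff)

lemma abs_word:
  "abs_grassmann (word w) = (gword w :: ('k::comm_ring_1, 'n) grassmann)"
proof (induction w)
  case Nil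
  have "word [] = (1 :: 'n list \<Rightarrow>\<^sub>0 'k)"
    by (simp flip: zero_list_def)
  then show ?case by (simp add: one_grassmann_def)
next
  case (Cons i w)
  have "abs_grassmann (word (i # w)) = abs_grassmann (word [i]) * (abs_grassmann (word w) :: ('k, 'n) grassmann)"
    by (simp add: times_grassmann.abs_eq mult_single plus_list_def)
  then show ?case
    using Cons by (simp add: gen.abs_eq)
qed

lemma abs_single: "abs_grassmann (Poly_Mapping.single w c) = scale c (gword w)"
  by (simp add: scale.abs_eq mult_single plus_list_def flip: abs_word)

lemma grassmann_induct [case_names word add scale]:
  fixes a :: "('k::comm_ring_1, 'n) grassmann"
  assumes "\<And>w. P (gword w)" "\<And>a b. P a \<Longrightarrow> P b \<Longrightarrow> P (a + b)" "\<And>c a. P a \<Longrightarrow> P (scale c a)"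
  shows "P a"
proof -
  have "P (abs_grassmann p)" for p
  proof (induction p rule: poly_mapping_single_induct)
    case zero
    \<comment> \<open>Zero is reached as the empty word scaled by \<open>0\<close>.\<close>
    show ?case using assms(3)[OF assms(1)[of "[]"], of 0] by (simp flip: zero_grassmann_def)
  next
    case (single k v)
    show ?case by (simp add: abs_single assms)
  next
    case (add f g)
    then show ?case using assms(2) by (simp flip: plus_grassmann.abs_eq)
  qed
  then show ?thesis by (metis abs_rep_grassmann)
qed

definition glinear :: "(('k::comm_ring_1, 'n) grassmann \<Rightarrow> ('k, 'm) grassmann) \<Rightarrow> bool" where
  "glinear f \<longleftrightarrow> (\<forall>a b. f (a + b) = f a + f b) \<and> (\<forall>c a. f (scale c a) = scale c (f a))"

lemma
  assumes "glinear f"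
  shows glinear_add: "f (a + b) = f a + f b"
    and glinear_scale: "f (scale c a) = scale c (f a)"
    and glinear_zero: "f 0 = 0"
    and glinear_uminus: "f (- a) = - f a"
    and glinear_diff: "f (a - b) = f a - f b"
proof -
  show add: "f (a + b) = f a + f b" and sc: "f (scale c a) = scale c (f a)" for a b c
    using assms by (auto simp: glinear_def)
  show z: "f 0 = 0" using sc[of 0 0] by simp
  show um: "f (- a) = - f a" for a
    using add[of "- a" a] z by (simp add: eq_neg_iff_add_eq_0)
  show "f (a - b) = f a - f b"
    using add[of a "- b"] um by simp
qed

lemma glinear_eqI:
  assumes "glinear f" "glinear g" "\<And>w. f (gword w) = g (gword w)"
  shows "f a = g a"
  by (induction a rule: grassmann_induct) (simp_all add: assms glinear_add glinear_scale)

definition lin_free :: "('n list \<Rightarrow> ('k, 'm) grassmann) \<Rightarrow> ('n list \<Rightarrow>\<^sub>0 'k::comm_ring_1) \<Rightarrow> ('k, 'm) grassmann"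
  where "lin_free f p = (\<Sum>w\<in>Poly_Mapping.keys p. scale (Poly_Mapping.lookup p w) (f w))"

lemma lin_free_superset:
  assumes "finite A" "Poly_Mapping.keys p \<subseteq> A"
  shows "lin_free f p = (\<Sum>w\<in>A. scale (Poly_Mapping.lookup p w) (f w))"
  unfolding lin_free_def using assms
  by (intro sum.mono_neutral_left) (auto simp: in_keys_iff)

lemma lin_free_single [simp]: "lin_free f (Poly_Mapping.single w c) = scale c (f w)"
  by (subst lin_free_superset[of "{w}"]) auto

lemma lin_free_zero [simp]: "lin_free f 0 = 0"
  by (simp add: lin_free_def)

lemma lin_free_add: "lin_free f (p + q) = lin_free f p + lin_free f q"
proof -
  let ?A = "Poly_Mapping.keys p \<union> Poly_Mapping.keys q"
  have "lin_free f r = (\<Sum>w\<in>?A. scale (Poly_Mapping.lookup r w) (f w))"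
    if "r \<in> {p, q, p + q}" for r
    using that keys_add[of p q] by (intro lin_free_superset) auto
  then show ?thesis
    by (simp add: lookup_add grassmann.scale_left_distrib sum.distrib)
qed

lemma lin_free_diff: "lin_free f (p - q) = lin_free f p - lin_free f q"
  using lin_free_add[of f "p - q" q] by simp

text \<open>A representative is chosen instead of lifting \<open>lin_free f\<close>, because
  well-definedness depends on \<open>f\<close>: the value is independent of the choice once
  \<open>lin_free f\<close> kills \<open>grassmann_ideal\<close>.\<close>

definition extend :: "('n list \<Rightarrow> ('k, 'm) grassmann) \<Rightarrow> ('k::comm_ring_1, 'n) grassmann \<Rightarrow> ('k, 'm) grassmann"
  where "extend f a = lin_free f (rep_grassmann a)"

text \<open>Universal property of the quotient as a module: all representatives give the same value,
  so additivity and scaling pass down from the free algebra.\<close>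

lemma
  assumes "\<And>p. p \<in> grassmann_ideal \<Longrightarrow> lin_free f p = 0"
  shows extend_gword: "extend f (gword w) = f w"
    and glinear_extend: "glinear (extend f)"
proof -
  have abs: "extend f (abs_grassmann p) = lin_free f p" for p
    using assms[of "rep_grassmann (abs_grassmann p) - p"] rel_rep_abs_grassmann[of p]
    by (simp add: extend_def grassmann_rel_def lin_free_diff)
  show "extend f (gword w) = f w"
    by (simp add: abs flip: abs_word)
  have sc: "lin_free f (Poly_Mapping.single [] c * p) = scale c (lin_free f p)" for c p
    by (induction p rule: poly_mapping_single_induct)
      (simp_all add: distrib_left lin_free_add mult_single plus_list_def grassmann.scale_right_distrib)
  have "extend f (abs_grassmann p + abs_grassmann q) = extend f (abs_grassmann p) + extend f (abs_grassmann q)"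
    for p q by (simp add: abs lin_free_add plus_grassmann.abs_eq)
  from this[of "rep_grassmann _" "rep_grassmann _"]
  have "extend f (a + b) = extend f a + extend f b" for a b
    by (simp add: abs_rep_grassmann)
  moreover have "extend f (scale c (abs_grassmann p)) = scale c (extend f (abs_grassmann p))" for c p
    by (simp add: abs sc scale.abs_eq)
  from this[of _ "rep_grassmann _"]
  have "extend f (scale c a) = scale c (extend f a)" for c a
    by (simp add: abs_rep_grassmann)
  ultimately show "glinear (extend f)"
    by (simp add: glinear_def)
qed

section \<open>Algebra homomorphisms given by the images of the generators\<close>

definition ghom :: "(('k::comm_ring_1, 'n) grassmann \<Rightarrow> ('k, 'm) grassmann) \<Rightarrow> bool" where
  "ghom f \<longleftrightarrow> glinear f \<and> f 1 = 1 \<and> (\<forall>a b. f (a * b) = f a * f b)"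

lemma
  assumes "ghom f"
  shows ghom_linear: "glinear f" and ghom_one: "f 1 = 1" and ghom_mult: "f (a * b) = f a * f b"
  using assms by (auto simp: ghom_def)

lemma ghom_gword: "ghom f \<Longrightarrow> f (gword w) = prod_list (map (\<lambda>i. f (gen i)) w)"
  by (induction w) (simp_all add: ghom_one ghom_mult)

lemma ghom_eqI:
  assumes "ghom f" "ghom g" "\<And>i. f (gen i) = g (gen i)"
  shows "f = g"
  using glinear_eqI[of f g] assms by (auto simp: ghom_linear ghom_gword)

definition hom_of :: "('n \<Rightarrow> ('k, 'm) grassmann) \<Rightarrow> ('k::comm_ring_1, 'n) grassmann \<Rightarrow> ('k, 'm) grassmann"
  where "hom_of y = extend (\<lambda>w. prod_list (map y w))"

text \<open>Universal property of the Grassmann algebra: the extension of \<open>y\<close> to the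
  free algebra is multiplicative, hence its vanishing on the defining relations propagates to the
  whole ideal.\<close>

lemma
  assumes sq: "\<And>i. y i * y i = 0" and anti: "\<And>i j. i \<noteq> j \<Longrightarrow> y i * y j + y j * y i = 0"
  shows ghom_hom_of: "ghom (hom_of y)" and hom_of_gen: "hom_of y (gen i) = y i"
proof -
  let ?f = "\<lambda>w. prod_list (map y w)"
  have mult: "lin_free ?f (p * q) = lin_free ?f p * lin_free ?f q" for p q
  proof (induction p rule: poly_mapping_single_induct)
    case (single k v)
    show ?case
      by (induction q rule: poly_mapping_single_induct)
        (simp_all add: distrib_left lin_free_add mult_single plus_list_def
          scale_mult_left scale_mult_right mult.commute)
  qed (simp_all add: distrib_right lin_free_add)
  have ideal: "lin_free ?f p = 0" if "p \<in> grassmann_ideal" for p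
    using that by induction (simp_all add: mult lin_free_add sq anti)
  show gen: "hom_of y (gen i) = y i" for i
    using extend_gword[of ?f, OF ideal, of "[i]"] by (simp add: hom_of_def)
  note lin = glinear_extend[of ?f, OF ideal, folded hom_of_def]
  note hw = extend_gword[of ?f, OF ideal, folded hom_of_def]
  have wm: "hom_of y (gword u * b) = hom_of y (gword u) * hom_of y b" for u b
  proof (induction b rule: grassmann_induct)
    case (word w)
    show ?case using hw[of "u @ w"] by (simp add: hw)
  qed (simp_all add: glinear_add[OF lin] glinear_scale[OF lin] distrib_left scale_mult_right)
  have "hom_of y (a * b) = hom_of y a * hom_of y b" for a b
    by (induction a rule: grassmann_induct)
      (simp_all add: wm glinear_add[OF lin] glinear_scale[OF lin] distrib_right scale_mult_left)
  then show "ghom (hom_of y)"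
    using lin hw[of "[]"] by (simp add: ghom_def)
qed

lemma gen_square: "gen i * gen i = (0 :: ('k::comm_ring_1, 'n) grassmann)"
  by transfer (simp add: grassmann_rel_def grassmann_ideal.square)

lemma gen_anticommute: "gen i * gen j = - (gen j * gen i :: ('k::comm_ring_1, 'n) grassmann)"
proof (cases "i = j")
  case False
  then have "gen i * gen j + gen j * gen i = (0 :: ('k, 'n) grassmann)"
    by transfer (simp add: grassmann_rel_def grassmann_ideal.anticommute)
  then show ?thesis by (simp add: eq_neg_iff_add_eq_0)
qed (simp add: gen_square)

section \<open>Skew derivations\<close>

text \<open>The grading involution. With \<open>parity a\<close> in place of the Leibniz sign, the
  product rule can be stated for all \<open>a\<close> and not only for homogeneous ones.\<close>

definition parity :: "('k::comm_ring_1, 'n) grassmann \<Rightarrow> ('k, 'n) grassmann" where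
  "parity = hom_of (\<lambda>i. - gen i)"

lemma ghom_parity: "ghom parity" and parity_gen: "parity (gen i) = - gen i"
  unfolding parity_def
  by (intro ghom_hom_of hom_of_gen; simp add: gen_square; metis gen_anticommute add.left_inverse)+

lemma parity_gword: "parity (gword w) = (-1) ^ length w * gword w"
  by (induction w) (simp_all add: ghom_one[OF ghom_parity] ghom_mult[OF ghom_parity] parity_gen
      minus_one_power_iff)

text \<open>The recursion is the skew Leibniz rule with the first letter split off; the values
  already lie in the quotient.\<close>

fun partial_word :: "'n \<Rightarrow> 'n list \<Rightarrow> ('k::comm_ring_1, 'n) grassmann" where
  "partial_word j [] = 0"
| "partial_word j (i # w) = (if j = i then gword w else 0) - gen i * partial_word j w"

lemma partial_word_append:
  "partial_word j (u @ v) = partial_word j u * gword v + (-1) ^ length u * gword u * partial_word j v"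
  by (induction u) (auto simp: algebra_simps minus_one_power_iff)

definition pd :: "'n \<Rightarrow> ('k::comm_ring_1, 'n) grassmann \<Rightarrow> ('k, 'n) grassmann" where
  "pd j = extend (partial_word j)"

text \<open>By the skew Leibniz rule, a product is killed as soon as one factor has both zero class
  and zero derivative. This reduces the claim to the defining relations.\<close>

lemma partial_word_ideal:
  assumes "p \<in> grassmann_ideal"
  shows "lin_free (partial_word j) p = 0"
proof -
  have 1: "lin_free (partial_word j) (p * q) = lin_free (partial_word j) p * abs_grassmann q
      + parity (abs_grassmann p) * lin_free (partial_word j) q" for p q
  proof (induction p rule: poly_mapping_single_induct)
    case zero
    show ?case by (simp add: glinear_zero[OF ghom_linear[OF ghom_parity]] flip: zero_grassmann_def)
  next
    case (single k v)
    show ?case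
    proof (induction q rule: poly_mapping_single_induct)
      case zero
      show ?case by (simp flip: zero_grassmann_def)
    next
      case (single l u)
      show ?case
        by (simp add: mult_single plus_list_def partial_word_append abs_single
            scale_mult_left scale_mult_right grassmann.scale_right_distrib parity_gword
            glinear_scale[OF ghom_linear[OF ghom_parity]] mult.commute)
    next
      case (add f g)
      then show ?case by (simp add: distrib_left lin_free_add flip: plus_grassmann.abs_eq)
    qed
  next
    case (add f g)
    then show ?case
      by (simp add: distrib_right lin_free_add glinear_add[OF ghom_linear[OF ghom_parity]]
          flip: plus_grassmann.abs_eq)
  qed
  have 0: "abs_grassmann p = 0" if "p \<in> grassmann_ideal" for p :: "'a list \<Rightarrow>\<^sub>0 'b"
    using that grassmann.abs_eq_iff[of p 0] by (simp add: grassmann_rel_def flip: zero_grassmann_def)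
  show ?thesis
    using assms
    by induction (auto simp: 1 0 lin_free_add glinear_zero[OF ghom_linear[OF ghom_parity]] mult_single
       plus_list_def)
qed

lemma pd_gword: "pd j (gword w) = partial_word j w" and glinear_pd: "glinear (pd j)"
  unfolding pd_def by (rule extend_gword glinear_extend, erule partial_word_ideal)+

lemma pd_gen: "pd j (gen k) = (if j = k then 1 else 0)"
  using pd_gword[of j "[k]"] by (cases "j = k") simp_all

lemma pd_one: "pd j 1 = 0"
  using pd_gword[of j "[]"] by simp

lemma pd_mult: "pd j (a * b) = pd j a * b + parity a * pd j b"
proof -
  note lin = glinear_add[OF glinear_pd] glinear_scale[OF glinear_pd]
    glinear_add[OF ghom_linear[OF ghom_parity]] glinear_scale[OF ghom_linear[OF ghom_parity]]
  have *: "pd j (gword u * b) = pd j (gword u) * b + parity (gword u) * pd j b" for u b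
  proof (induction b rule: grassmann_induct)
    case (word w)
    show ?case using pd_gword[of j "u @ w"]
      by (simp add: pd_gword partial_word_append parity_gword)
  qed (simp_all add: lin distrib_left scale_mult_right grassmann.scale_right_distrib)
  show ?thesis
    by (induction a rule: grassmann_induct)
      (simp_all add: * lin distrib_right scale_mult_left grassmann.scale_right_distrib)
qed

lemma parity_component:
  assumes "a \<in> component i"
  shows "parity a = (-1) ^ i * a"
proof -
  note lin = glinear_add[OF ghom_linear[OF ghom_parity]] glinear_scale[OF ghom_linear[OF ghom_parity]]
  show ?thesis
    using assms unfolding component_def
    by (induction rule: grassmann.span_induct_alt)
      (auto simp: lin glinear_zero[OF ghom_linear[OF ghom_parity]] parity_gword distrib_left scale_mult_right)
qed

text \<open>\<open>pd j\<close> gives existence. For uniqueness, words are homogeneous, so the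
  Leibniz rule forces the recursion of \<open>partial_word\<close> on any candidate.\<close>

lemma skew_partial_eq: "skew_partial j = pd j"
  unfolding skew_partial_def
proof (rule the_equality)
  show "is_skew_partial j (pd j)"
    by (auto simp: is_skew_partial_def glinear_add[OF glinear_pd] glinear_scale[OF glinear_pd]
        pd_gen pd_mult parity_component)
next
  fix D assume D: "is_skew_partial j D"
  then have lin: "glinear D"
    by (simp add: is_skew_partial_def glinear_def)
  have gw: "gword w \<in> component (length w)" for w
    unfolding component_def by (intro grassmann.span_base) auto
  have mult: "D (gword u * b) = D (gword u) * b + (- 1) ^ length u * gword u * D b" for u b
    using D gw unfolding is_skew_partial_def by blast
  have gen: "D (gen k) = (if j = k then 1 else 0)" for k
    using D unfolding is_skew_partial_def by blast
  \<comment> \<open>The rule applied to \<open>1 * 1\<close> gives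
    \<open>D 1 = D 1 + D 1\<close>.\<close>
  have 1: "D 1 = 0"
    using mult[of "[]" 1] by simp
  have "D (gword w) = partial_word j w" for w
  proof (induction w)
    case (Cons i w)
    show ?case
      using mult[of "[i]" "gword w"] by (simp add: gen Cons)
  qed (simp add: 1)
  then show "D = pd j"
    using glinear_eqI[OF lin glinear_pd] by (auto simp: pd_gword)
qed

section \<open>The monomial basis and the grading\<close>

lemma gen_left_anticommute: "gen i * (gen j * a) = - (gen j * (gen i * a))"
  by (simp only: mult.assoc[symmetric] gen_anticommute[of i j] mult_minus_left)

lemma gen_gword_commute:
  "gen i * gword v = (-1) ^ length v * (gword v * gen i :: ('k::comm_ring_1, 'n) grassmann)"
proof (induction v)
  case (Cons j v)
  have "gen i * gword (j # v) = - (gen j * ((-1) ^ length v * (gword v * gen i)) :: ('k, 'n) grassmann)"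
    by (simp add: gen_left_anticommute[of i j] flip: Cons)
  then show ?case
    by (cases "even (length v)") (simp_all add: mult.assoc)
qed simp

lemma gword_commute:
  "gword u * gword v = (-1) ^ (length u * length v) * (gword v * gword u :: ('k::comm_ring_1, 'n) grassmann)"
proof (induction u)
  case (Cons i u)
  have "gword (i # u) * gword v = (gen i * (gword u * gword v) :: ('k, 'n) grassmann)"
    by (simp add: mult.assoc)
  also have "\<dots> = (-1) ^ (length u * length v) * (gen i * gword v * gword u)"
    unfolding Cons by (cases "even (length u) \<or> even (length v)") (auto simp: mult.assoc)
  also have "\<dots> = (-1) ^ (length (i # u) * length v) * (gword v * gword (i # u))"
    unfolding gen_gword_commute[of i v]
    by (simp add: power_add mult.assoc) (cases "even (length v)"; simp)
  finally show ?case .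
qed simp

text \<open>Two equal letters can be moved next to each other at the cost of a sign, and then
  \<open>gen_square\<close> applies.\<close>

lemma gword_not_distinct:
  assumes "\<not> distinct w"
  shows "gword w = (0 :: ('k::comm_ring_1, 'n) grassmann)"
proof -
  obtain u i v x where w: "w = u @ [i] @ v @ [i] @ x"
    using not_distinct_decomp[OF assms] by blast
  have "gen i * gword v * gen i = ((-1) ^ length v * (gword v * (gen i * gen i)) :: ('k, 'n) grassmann)"
    unfolding gen_gword_commute[of i v] by (simp add: mult.assoc)
  moreover have "gword w = (gword u * (gen i * gword v * gen i) * gword x :: ('k, 'n) grassmann)"
    by (simp add: w mult.assoc)
  ultimately show ?thesis by (simp add: gen_square)
qed

section \<open>Coefficients of monomials, read off by repeated differentiation\<close>

lift_definition aug :: "('k::comm_ring_1, 'n) grassmann \<Rightarrow> 'k" is "\<lambda>p. Poly_Mapping.lookup p []"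
  using grassmann_ideal_lookup_Nil by (fastforce simp: grassmann_rel_def lookup_minus)

lemma aug_zero [simp]: "aug 0 = 0"
  by transfer simp

lemma aug_one [simp]: "aug 1 = 1"
  by transfer (simp add: lookup_one zero_list_def)

lemma aug_add: "aug (a + b) = aug a + aug b"
  by transfer (rule lookup_add)

lemma aug_mult: "aug (a * b) = aug a * aug b"
  by transfer (rule lookup_mult_Nil)

lemma aug_scale: "aug (scale c a) = c * aug a"
  by transfer (simp add: lookup_mult_Nil)

lemma aug_gen [simp]: "aug (gen i) = 0"
  by transfer (simp add: lookup_single)

lemma aug_uminus: "aug (- a) = - aug a"
  by transfer simp

lemma aug_diff: "aug (a - b) = aug a - aug b"
  by transfer (simp add: lookup_minus)

lemma partial_word_notin: "j \<notin> set w \<Longrightarrow> partial_word j w = 0"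
  by (induction w) auto

text \<open>The scalar \<open>e\<close> comes out as a sign; it is left unspecified because only the
  remaining word matters later.\<close>

lemma partial_word_distinct:
  assumes "distinct w" "j \<in> set w"
  obtains e where "partial_word j w = scale e (gword (remove1 j w) :: ('k::comm_ring_1, 'n) grassmann)"
proof -
  have "\<exists>e. partial_word j w = scale e (gword (remove1 j w) :: ('k, 'n) grassmann)"
    using assms
  proof (induction w)
    case (Cons i w)
    show ?case
    proof (cases "j = i")
      case True
      with Cons have "partial_word j (i # w) = scale 1 (gword (remove1 j (i # w)) :: ('k, 'n) grassmann)"
        by (simp add: partial_word_notin)
      then show ?thesis by blast
    next
      case False
      with Cons obtain e where "partial_word j w = scale e (gword (remove1 j w) :: ('k, 'n) grassmann)" by auto
      with False have "partial_word j (i # w) = scale (- e) (gword (remove1 j (i # w)) :: ('k, 'n) grassmann)"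
        by (simp add: scale_mult_right)
      then show ?thesis by blast
    qed
  qed simp
  with that show ?thesis by blast
qed

lemma glinear_fold_pd: "glinear (fold pd ss)"
  by (induction ss) (auto simp: glinear_def glinear_add[OF glinear_pd] glinear_scale[OF glinear_pd])

text \<open>Differentiating along \<open>S\<close> in increasing order turns the monomial of
  \<open>S\<close> into 1, and the augmentation discards what is left of the other monomials. Built
  from maps on the quotient, the coefficient is well defined before any basis is known.\<close>

definition coeff :: "'n::linorder set \<Rightarrow> ('k::comm_ring_1, 'n) grassmann \<Rightarrow> 'k" where
  "coeff S a = aug (fold pd (sorted_list_of_set S) a)"

abbreviation monomial :: "'n::linorder set \<Rightarrow> ('k::comm_ring_1, 'n) grassmann" where
  "monomial S \<equiv> gword (sorted_list_of_set S)"

lemma coeff_zero [simp]: "coeff S 0 = 0"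
  by (simp add: coeff_def glinear_zero[OF glinear_fold_pd])

lemma coeff_add: "coeff S (a + b) = coeff S a + coeff S b"
  by (simp add: coeff_def glinear_add[OF glinear_fold_pd] aug_add)

lemma coeff_scale: "coeff S (scale c a) = c * coeff S a"
  by (simp add: coeff_def glinear_scale[OF glinear_fold_pd] aug_scale)

lemma coeff_uminus: "coeff S (- a) = - coeff S a"
  by (simp add: coeff_def glinear_uminus[OF glinear_fold_pd] aug_uminus)

lemma coeff_diff: "coeff S (a - b) = coeff S a - coeff S b"
  using coeff_add[of S a "- b"] by (simp add: coeff_uminus)

lemma coeff_empty: "coeff {} a = aug a"
  by (simp add: coeff_def)

text \<open>Each derivative deletes its letter from the word, or gives 0 if the letter is missing.
  If letters survive all derivatives, the augmentation kills the result.\<close>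

lemma coeff_gword_eq_0:
  fixes S :: "'n::{finite,linorder} set"
  assumes "distinct w" "set w \<noteq> S"
  shows "coeff S (gword w :: ('k::comm_ring_1, 'n) grassmann) = 0"
proof -
  have "aug (fold pd ss (gword w :: ('k, 'n) grassmann)) = 0" if "distinct ss" "set w \<noteq> set ss" for ss :: "'n list"
    using that assms(1)
  proof (induction ss arbitrary: w)
    case Nil
    then obtain i v where "w = i # v" by (cases w) auto
    then show ?case by (simp add: aug_mult)
  next
    case (Cons s ss)
    show ?case
    proof (cases "s \<in> set w")
      case True
      with Cons.prems obtain e where e: "partial_word s w = scale e (gword (remove1 s w) :: ('k, 'n) grassmann)"
        using partial_word_distinct[of w s] by blast
      have "set (remove1 s w) \<noteq> set ss"
        using True Cons.prems by auto
      with Cons have "aug (fold pd ss (gword (remove1 s w) :: ('k, 'n) grassmann)) = 0"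
        by simp
      then show ?thesis
        by (simp add: pd_gword e glinear_scale[OF glinear_fold_pd] aug_scale)
    qed (simp add: pd_gword partial_word_notin glinear_zero[OF glinear_fold_pd])
  qed
  with assms show ?thesis by (simp add: coeff_def)
qed

text \<open>Together with \<open>monomial_expansion\<close> this makes the monomials a basis indexed
  by sets of generators.\<close>

lemma coeff_monomial:
  fixes S T :: "'n::{finite,linorder} set"
  shows "coeff S (monomial T :: ('k::comm_ring_1, 'n) grassmann) = (if S = T then 1 else 0)"
proof (cases "S = T")
  case True
  \<comment> \<open>The derivatives follow the order of the word, so each strips the leading letter
    and no sign appears.\<close>
  have "fold pd w (gword w) = (1 :: ('k, 'n) grassmann)" if "distinct w" for w :: "'n list"
    using that
  proof (induction w)
    case (Cons i w)
    then have "pd i (gword (i # w)) = (gword w :: ('k, 'n) grassmann)"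
      by (subst pd_gword) (simp add: partial_word_notin)
    with Cons show ?case by simp
  qed simp
  with True show ?thesis by (simp add: coeff_def)
qed (simp add: coeff_gword_eq_0)

text \<open>Insertion sort with one use of \<open>gen_left_anticommute\<close> per swap; the
  accumulated sign is absorbed in \<open>e\<close>.\<close>

lemma gword_sort:
  fixes w :: "'n::linorder list"
  obtains e where "gword w = scale e (gword (sort w) :: ('k::comm_ring_1, 'n) grassmann)"
proof -
  have ins: "\<exists>e. gword (i # w) = scale e (gword (insort i w) :: ('k, 'n) grassmann)" for i and w :: "'n list"
  proof (induction w)
    case Nil
    have "gword [i] = scale 1 (gword (insort i []) :: ('k, 'n) grassmann)" by simp
    then show ?case by blast
  next
    case (Cons j w)
    show ?case
    proof (cases "i \<le> j")
      case True
      then have "gword (i # j # w) = scale 1 (gword (insort i (j # w)) :: ('k, 'n) grassmann)" by simp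
      then show ?thesis by blast
    next
      case False
      from Cons obtain e where e: "gword (i # w) = scale e (gword (insort i w) :: ('k, 'n) grassmann)" by blast
      have "gword (i # j # w) = - (gen j * gword (i # w) :: ('k, 'n) grassmann)"
        by (simp add: gen_left_anticommute[of i j])
      also have "\<dots> = scale (- e) (gword (insort i (j # w)))"
        using False unfolding e by (simp add: scale_mult_right)
      finally show ?thesis by blast
    qed
  qed
  have "\<exists>e. gword w = scale e (gword (sort w) :: ('k, 'n) grassmann)"
  proof (induction w)
    case Nil
    have "gword [] = scale 1 (gword (sort []) :: ('k, 'n) grassmann)" by simp
    then show ?case by blast
  next
    case (Cons i w)
    then obtain e where e: "gword w = scale e (gword (sort w) :: ('k, 'n) grassmann)" by blast
    obtain f where "gword (i # sort w) = scale f (gword (insort i (sort w)) :: ('k, 'n) grassmann)"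
      using ins by blast
    then have "gword (i # w) = scale (e * f) (gword (sort (i # w)) :: ('k, 'n) grassmann)"
      by (simp add: e scale_mult_right)
    then show ?case by blast
  qed
  with that show ?thesis by blast
qed

text \<open>A word with a repeated letter is 0, and any other is a multiple of the monomial of its
  letters; \<open>coeff_monomial\<close> identifies the factor.\<close>

lemma monomial_expansion:
  fixes a :: "('k::comm_ring_1, 'n::{finite,linorder}) grassmann"
  shows "a = (\<Sum>S\<in>UNIV. scale (coeff S a) (monomial S))"
proof (induction a rule: grassmann_induct)
  case (word w)
  show ?case
  proof (cases "distinct w")
    case True
    obtain e where "gword w = scale e (gword (sort w) :: ('k, 'n) grassmann)"
      by (rule gword_sort)
    then have "gword w = scale e (monomial (set w) :: ('k, 'n) grassmann)"
      using True by (simp add: sorted_list_of_set_sort_remdups distinct_remdups_id)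
    then show ?thesis
      by (simp add: coeff_scale coeff_monomial if_distrib if_distribR sum.delta cong: if_cong)
  qed (simp add: gword_not_distinct)
next
  case (add a b)
  then show ?case by (simp add: coeff_add grassmann.scale_left_distrib sum.distrib)
next
  case (scale c a)
  then show ?case
    by (simp add: coeff_scale flip: grassmann.scale_scale grassmann.scale_sum_right)
qed

section \<open>Graded components and their description by support\<close>

lemma components_eq_span: "components D = lspan {gword w | w. length w \<in> D}"
proof
  show "components D \<subseteq> lspan {gword w | w. length w \<in> D}"
    unfolding components_def
  proof (intro grassmann.span_minimal grassmann.subspace_span UN_least)
    fix d assume "d \<in> D"
    then show "component d \<subseteq> lspan {gword w | w. length w \<in> D}"
      unfolding component_def by (intro grassmann.span_mono) auto
  qed
  show "lspan {gword w | w. length w \<in> D} \<subseteq> components D"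
    unfolding components_def component_def
    by (intro grassmann.span_mono) (auto intro: grassmann.span_base)
qed

lemma components_gword: "length w \<in> D \<Longrightarrow> gword w \<in> components D"
  unfolding components_eq_span by (auto intro: grassmann.span_base)

lemma
  shows components_zero [simp]: "0 \<in> components D"
    and components_add: "a \<in> components D \<Longrightarrow> b \<in> components D \<Longrightarrow> a + b \<in> components D"
    and components_diff: "a \<in> components D \<Longrightarrow> b \<in> components D \<Longrightarrow> a - b \<in> components D"
    and components_uminus: "a \<in> components D \<Longrightarrow> - a \<in> components D"
    and components_scale: "a \<in> components D \<Longrightarrow> scale c a \<in> components D"
    and components_sum: "(\<And>i. i \<in> A \<Longrightarrow> f i \<in> components D) \<Longrightarrow> sum f A \<in> components D"
  by (simp_all add: components_eq_span grassmann.span_zero grassmann.span_add grassmann.span_diff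
      grassmann.span_neg grassmann.span_scale grassmann.span_sum)

lemma components_mono: "D \<subseteq> E \<Longrightarrow> components D \<subseteq> components E"
  unfolding components_eq_span by (intro grassmann.span_mono) auto

lemma components_induct [consumes 1, case_names zero word add scale]:
  assumes "a \<in> components D" "P 0" "\<And>w. length w \<in> D \<Longrightarrow> P (gword w)"
    "\<And>a b. a \<in> components D \<Longrightarrow> b \<in> components D \<Longrightarrow> P a \<Longrightarrow> P b \<Longrightarrow> P (a + b)"
    "\<And>c a. a \<in> components D \<Longrightarrow> P a \<Longrightarrow> P (scale c a)"
  shows "P a"
proof -
  have "a \<in> components D \<and> P a"
    using assms(1) unfolding components_eq_span
    by (induction rule: grassmann.span_induct_alt)
      (auto simp flip: components_eq_span intro!: assms(2-) components_add components_scale components_gword)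
  then show ?thesis ..
qed

text \<open>The monomial basis turns membership into a condition on the support, from which
  intersections of components and vanishing above the top degree follow at once.\<close>

lemma components_eq_coeff:
  fixes D :: "nat set"
  shows "components D =
    {a :: ('k::comm_ring_1, 'n::{finite,linorder}) grassmann. \<forall>S. coeff S a \<noteq> 0 \<longrightarrow> card S \<in> D}"
proof (intro equalityI subsetI CollectI allI)
  fix a :: "('k, 'n) grassmann" and S
  assume "a \<in> components D"
  then show "coeff S a \<noteq> 0 \<longrightarrow> card S \<in> D"
  proof (induction rule: components_induct)
    case (word w)
    then show ?case
      by (metis coeff_gword_eq_0 coeff_zero distinct_card gword_not_distinct)
  next
    case (add a b)
    then show ?case by (force simp: coeff_add)
  qed (auto simp: coeff_scale)
next
  fix a :: "('k, 'n) grassmann"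
  assume a: "a \<in> {a. \<forall>S. coeff S a \<noteq> 0 \<longrightarrow> card S \<in> D}"
  have "scale (coeff S a) (monomial S) \<in> components D" for S
    using a by (cases "coeff S a = 0") (auto intro!: components_scale components_gword)
  then have "(\<Sum>S\<in>UNIV. scale (coeff S a) (monomial S)) \<in> components D"
    by (rule components_sum)
  then show "a \<in> components D"
    by (simp flip: monomial_expansion)
qed

lemma components_Int:
  "components D \<inter> components E =
    (components (D \<inter> E) :: ('k::comm_ring_1, 'n::{finite,linorder}) grassmann set)"
  by (auto simp: components_eq_coeff)

lemma components_mult:
  assumes "a \<in> components D" "b \<in> components E" "\<And>d e. d \<in> D \<Longrightarrow> e \<in> E \<Longrightarrow> d + e \<in> F"
  shows "a * b \<in> components F"
  using assms(1)
proof (induction rule: components_induct)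
  case (word u)
  show ?case
    using assms(2)
  proof (induction rule: components_induct)
    case (word v)
    with assms(3) \<open>length u \<in> D\<close> show ?case
      using components_gword[of "u @ v" F] by simp
  qed (auto simp: distrib_left scale_mult_right intro: components_add components_scale)
qed (auto simp: distrib_right scale_mult_left intro: components_add components_scale)

lemma components_UNIV: "components UNIV = (UNIV :: ('k::comm_ring_1, 'n) grassmann set)"
proof -
  have "a \<in> components UNIV" for a :: "('k, 'n) grassmann"
    by (induction a rule: grassmann_induct)
      (auto intro: components_gword components_add components_scale)
  then show ?thesis by auto
qed

lemma components_one: "0 \<in> D \<Longrightarrow> 1 \<in> components D"
  using components_gword[of "[]" D] by simp

lemma components_gen: "1 \<in> D \<Longrightarrow> gen i \<in> components D"
  using components_gword[of "[i]" D] by simp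

text \<open>A word of length at least \<open>Suc k\<close> is its first letter times a word of
  length at least \<open>k\<close>; conversely degrees add.\<close>

lemma max_ideal_power_eq: "max_ideal_power k = (components {k..} :: ('k::comm_ring_1, 'n) grassmann set)"
proof (induction k)
  case 0
  show ?case by (simp add: atLeast_0 components_UNIV)
next
  case (Suc k)
  show ?case
  proof
    show "max_ideal_power (Suc k) \<subseteq> (components {Suc k..} :: ('k, 'n) grassmann set)"
      unfolding max_ideal_power.simps Suc
    proof (rule grassmann.span_minimal)
      show "{a * b |a b. a \<in> components {1..} \<and> b \<in> components {k..}} \<subseteq> (components {Suc k..} :: ('k, 'n) grassmann set)"
        by (auto intro!: components_mult[where D = "{1..}" and E = "{k..}"])
      show "grassmann.subspace (components {Suc k..} :: ('k, 'n) grassmann set)"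
        by (simp add: components_eq_span)
    qed
    show "(components {Suc k..} :: ('k, 'n) grassmann set) \<subseteq> max_ideal_power (Suc k)"
      unfolding components_eq_span[of "{Suc k..}"] max_ideal_power.simps Suc
    proof (intro grassmann.span_mono subsetI)
      fix a :: "('k, 'n) grassmann" assume "a \<in> {gword w |w. length w \<in> {Suc k..}}"
      then obtain i w where "a = gen i * gword w" "length w \<ge> k"
        by (auto simp: Suc_le_length_iff)
      then show "a \<in> {a * b |a b. a \<in> components {1..} \<and> b \<in> components {k..}}"
        by (force intro: components_gen components_gword)
    qed
  qed
qed

lemma pd_components:
  fixes a :: "('k::comm_ring_1, 'n) grassmann"
  assumes "a \<in> components D" "\<And>d. Suc d \<in> D \<Longrightarrow> d \<in> E"
  shows "pd j a \<in> components E"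
  using assms(1)
proof (induction rule: components_induct)
  case (word w)
  show ?case
  proof (cases "distinct w \<and> j \<in> set w")
    case True
    then obtain e where "partial_word j w = scale e (gword (remove1 j w) :: ('k, 'n) grassmann)"
      using partial_word_distinct[of w j] by metis
    moreover have "Suc (length (remove1 j w)) = length w"
      using True by (auto simp: length_remove1 dest: length_pos_if_in_set)
    then have "length (remove1 j w) \<in> E"
      using word by (intro assms(2)) simp
    ultimately show ?thesis by (simp add: pd_gword components_scale components_gword)
  next
    case False
    then have "pd j (gword w :: ('k, 'n) grassmann) = 0"
      using gword_not_distinct[of w, where 'k = 'k]
      by (cases "distinct w") (simp add: pd_gword partial_word_notin, simp add: glinear_zero[OF glinear_pd])
    then show ?thesis by simp
  qed
qed (auto simp: glinear_zero[OF glinear_pd] glinear_add[OF glinear_pd] glinear_scale[OF glinear_pd]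
    intro: components_add components_scale)

section \<open>Commutation rules according to parity\<close>

lemma even_components_commute:
  assumes "a \<in> components {d. even d}"
  shows "a * b = b * a"
  using assms
proof (induction rule: components_induct)
  case (word u)
  show ?case
  proof (induction b rule: grassmann_induct)
    case (word v)
    show ?case using \<open>length u \<in> {d. even d}\<close> by (simp add: gword_commute[of u v])
  qed (simp_all add: distrib_left distrib_right scale_mult_left scale_mult_right)
qed (simp_all add: distrib_left distrib_right scale_mult_left scale_mult_right)

lemma odd_components_anticommute:
  assumes "a \<in> components {d. odd d}" "b \<in> components {d. odd d}"
  shows "a * b = - (b * a)"
  using assms(1)
proof (induction rule: components_induct)
  case (word u)
  show ?case
    using assms(2)
  proof (induction rule: components_induct)
    case (word v)
    then show ?case using \<open>length u \<in> {d. odd d}\<close> by (simp add: gword_commute[of u v])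
  qed (simp_all add: distrib_left distrib_right scale_mult_left scale_mult_right)
qed (simp_all add: distrib_left distrib_right scale_mult_left scale_mult_right)

text \<open>Anticommutation alone gives \<open>2 * (a * a) = 0\<close>, which is too weak when 2 is
  a zero divisor. Instead, squares of odd words vanish and the cross terms of a sum cancel.\<close>

lemma odd_components_square:
  fixes a :: "('k::comm_ring_1, 'n) grassmann"
  assumes "a \<in> components {d. odd d}"
  shows "a * a = 0"
  using assms
proof (induction rule: components_induct)
  case (word w)
  \<comment> \<open>Odd length rules out the empty word.\<close>
  then have "\<not> distinct (w @ w)" by (cases w) auto
  from gword_not_distinct[OF this, where 'k = 'k] show ?case by simp
next
  case (add a b)
  then show ?case
    using odd_components_anticommute[of a b] by (simp add: distrib_left distrib_right)
qed (simp_all add: scale_mult_left scale_mult_right)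

lemma parity_even: "a \<in> components {d. even d} \<Longrightarrow> parity a = a"
  by (induction rule: components_induct)
    (simp_all add: parity_gword glinear_zero glinear_add glinear_scale ghom_linear[OF ghom_parity])

lemma parity_odd: "a \<in> components {d. odd d} \<Longrightarrow> parity a = - a"
  by (induction rule: components_induct)
    (simp_all add: parity_gword glinear_zero glinear_add glinear_scale ghom_linear[OF ghom_parity])

lemma components_above_card:
  fixes a :: "('k::comm_ring_1, 'n::{finite,linorder}) grassmann"
  assumes "a \<in> components {card (UNIV :: 'n set)<..}"
  shows "a = 0"
proof -
  have "coeff S a = 0" for S
    using assms card_mono[of UNIV S] unfolding components_eq_coeff by fastforce
  then show ?thesis
    using monomial_expansion[of a] by simp
qed

section \<open>The group of automorphisms\<close>

text \<open>Membership in \<Gamma> without bijectivity, which is automatic by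
  \<open>near_id_bij\<close>; \<open>Gamma_eq\<close> identifies the two.\<close>

abbreviation near_id :: "(('k::comm_ring_1, 'n) grassmann \<Rightarrow> ('k, 'n) grassmann) \<Rightarrow> bool" where
  "near_id \<sigma> \<equiv> ghom \<sigma> \<and> (\<forall>i. \<sigma> (gen i) - gen i \<in> components {d. odd d \<and> 3 \<le> d})"

text \<open>Degree sets whose components every \<open>near_id\<close> map preserves, since such a
  map only adds terms of higher degree and the same parity.\<close>

definition upclosed :: "nat set \<Rightarrow> bool" where
  "upclosed D \<longleftrightarrow> (\<forall>d\<in>D. \<forall>e\<ge>d. even e = even d \<longrightarrow> e \<in> D)"

lemma near_id_gen_odd:
  assumes "near_id \<sigma>"
  shows "\<sigma> (gen i) \<in> components {d. odd d}"
proof -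
  have "\<sigma> (gen i) - gen i + gen i \<in> components {d. odd d}"
    using assms components_mono[of "{d. odd d \<and> 3 \<le> d}" "{d. odd d}"]
    by (intro components_add components_gen) auto
  then show ?thesis by simp
qed

text \<open>Telescoping: the displacement of a product \<open>x * w\<close> is
  \<open>(\<sigma> x - x) * \<sigma> w + x * (\<sigma> w - w)\<close>, and both summands raise the
  degree by at least 2.\<close>

lemma near_id_gword:
  assumes "near_id \<sigma>"
  shows "\<sigma> (gword w) - gword w \<in> components {d. length w + 2 \<le> d \<and> even d = even (length w)}"
proof (induction w)
  case (Cons i w)
  let ?D = "\<lambda>m. {d. m + 2 \<le> d \<and> even d = even m}"
  let ?E = "{d. length w \<le> d \<and> even d = even (length w)}"
  note hom = ghom_mult[of \<sigma>]
  have "\<sigma> (gword w) - gword w + gword w \<in> components ?E"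
    by (intro components_add components_gword subsetD[OF components_mono Cons]) auto
  then have 1: "\<sigma> (gword w) \<in> components ?E" by simp
  have gen: "\<sigma> (gen i) - gen i \<in> components {d. odd d \<and> 3 \<le> d}"
    using assms by blast
  have "(\<sigma> (gen i) - gen i) * \<sigma> (gword w) + gen i * (\<sigma> (gword w) - gword w)
      \<in> components (?D (length (i # w)))"
    by (intro components_add components_mult[OF gen 1]
        components_mult[OF components_gen[of "{1}"] Cons]) auto
  then show ?case
    using assms by (simp add: hom algebra_simps)
qed (use assms in \<open>simp add: ghom_one\<close>)

text \<open>This unipotence drives the arguments by degree that follow.\<close>

lemma near_id_diff:
  assumes "near_id \<sigma>" "a \<in> components D"
    and "\<And>d e. d \<in> D \<Longrightarrow> d + 2 \<le> e \<Longrightarrow> even e = even d \<Longrightarrow> e \<in> E"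
  shows "\<sigma> a - a \<in> components E"
proof -
  have lin: "glinear \<sigma>" using assms(1) ghom_linear by blast
  show ?thesis
    using assms(2)
  proof (induction rule: components_induct)
    case (word w)
    then have "components {d. length w + 2 \<le> d \<and> even d = even (length w)} \<subseteq>
        (components E :: ('a, 'b) grassmann set)"
      using assms(3) by (intro components_mono) auto
    with near_id_gword[OF assms(1)] show ?case by blast
  next
    case (add a b)
    have "\<sigma> (a + b) - (a + b) = (\<sigma> a - a) + (\<sigma> b - b)"
      by (simp add: glinear_add[OF lin])
    with add show ?case by (simp only: components_add)
  next
    case (scale c a)
    then show ?case
      by (simp add: glinear_scale[OF lin] components_scale flip: grassmann.scale_right_diff_distrib)
  qed (simp add: glinear_zero[OF lin])
qed

lemma near_id_components:
  assumes "near_id \<sigma>" "a \<in> components D" "upclosed D"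
  shows "\<sigma> a \<in> components D"
proof -
  have "\<sigma> a - a \<in> components D"
    using assms(1,2) by (rule near_id_diff) (use assms(3) in \<open>auto simp: upclosed_def\<close>)
  from components_add[OF this assms(2)] show ?thesis by simp
qed

text \<open>Successive approximation: \<open>b\<close> maps to itself up to an error of higher
  degree, and adding to \<open>b\<close> a preimage of the negated error corrects it. The process
  stops above the top degree.\<close>

lemma near_id_surj_components:
  fixes \<sigma> :: "('k::comm_ring_1, 'n::{finite,linorder}) grassmann \<Rightarrow> ('k, 'n) grassmann"
  assumes "near_id \<sigma>" "upclosed D" "b \<in> components D"
  shows "\<exists>a \<in> components D. \<sigma> a = b"
proof -
  have lin: "glinear \<sigma>" using assms(1) ghom_linear by blast
  \<comment> \<open>\<open>k\<close> bounds the degrees of \<open>b\<close> from below and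
    \<open>m\<close> counts the degrees still to be treated; at \<open>m = 0\<close> only degrees
    above the top one are left.\<close>
  have "\<exists>a \<in> components D. \<sigma> a = b"
    if "k + m = card (UNIV :: 'n set) + 1" "b \<in> components (D \<inter> {k..})" for k m b
    using that
  proof (induction m arbitrary: k b)
    case 0
    then have "b \<in> components {card (UNIV :: 'n set)<..}"
      by (elim subsetD[OF components_mono, rotated]) auto
    then have "b = 0" by (rule components_above_card)
    then show ?case
      using glinear_zero[OF lin] by (intro bexI[of _ 0]) auto
  next
    case (Suc m)
    have "\<sigma> b - b \<in> components (D \<inter> {Suc k..})"
      using assms(1) Suc.prems(2) by (rule near_id_diff) (use assms(2) in \<open>auto simp: upclosed_def\<close>)
    then have "- (\<sigma> b - b) \<in> components (D \<inter> {Suc k..})"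
      by (rule components_uminus)
    with Suc.IH[of "Suc k" "- (\<sigma> b - b)"] Suc.prems(1)
    obtain a where a: "a \<in> components D" "\<sigma> a = - (\<sigma> b - b)" by auto
    have "b \<in> components D"
      using Suc.prems(2) components_mono[of "D \<inter> {k..}" D] by auto
    with a show ?case
      by (intro bexI[of _ "a + b"]) (simp_all add: glinear_add[OF lin] components_add)
  qed
  from this[of 0 "card (UNIV :: 'n set) + 1" b] assms(3) show ?thesis
    by (simp add: atLeast_0)
qed

text \<open>A kernel element is minus its own displacement, so its lower degree bound can be raised
  until it is 0. Surjectivity is the approximation lemma with all degrees allowed.\<close>

lemma near_id_bij:
  fixes \<sigma> :: "('k::comm_ring_1, 'n::{finite,linorder}) grassmann \<Rightarrow> ('k, 'n) grassmann"
  assumes "near_id \<sigma>"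
  shows "bij \<sigma>"
proof (rule bijI)
  have lin: "glinear \<sigma>" using assms ghom_linear by blast
  have "a = 0" if "\<sigma> a = 0" for a
  proof -
    have "a \<in> components {k..}" for k
    proof (induction k)
      case (Suc k)
      have "\<sigma> a - a \<in> components {Suc k..}"
        using assms Suc by (rule near_id_diff) auto
      from components_uminus[OF this] that show ?case by simp
    qed (simp add: atLeast_0 components_UNIV)
    then have "a \<in> components {card (UNIV :: 'n set)<..}"
      by (simp add: greaterThan_def flip: Suc_le_eq atLeast_def)
    then show ?thesis by (rule components_above_card)
  qed
  then show "inj \<sigma>"
    using glinear_diff[OF lin] by (intro injI) (metis eq_iff_diff_eq_0)
  show "surj \<sigma>"
    using near_id_surj_components[OF assms, of UNIV]
    by (auto simp: upclosed_def components_UNIV surj_def) metis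
qed

lemma Gamma_eq:
  "Gamma = {\<sigma> :: ('k::comm_ring_1, 'n::{finite,linorder}) grassmann \<Rightarrow> ('k, 'n) grassmann. near_id \<sigma>}"
proof -
  have "is_algebra_automorphism \<sigma> \<longleftrightarrow> bij \<sigma> \<and> ghom \<sigma>"
    for \<sigma> :: "('k, 'n) grassmann \<Rightarrow> ('k, 'n) grassmann"
    unfolding is_algebra_automorphism_def ghom_def glinear_def by blast
  moreover have "components {d. odd d} \<inter> max_ideal_power 3 =
      (components {d. odd d \<and> 3 \<le> d} :: ('k, 'n) grassmann set)"
    unfolding max_ideal_power_eq components_Int by (rule arg_cong[of _ _ components]) auto
  ultimately show ?thesis
    using near_id_bij unfolding Gamma_def by blast
qed

lemma near_id_inv_components:
  fixes \<sigma> :: "('k::comm_ring_1, 'n::{finite,linorder}) grassmann \<Rightarrow> ('k, 'n) grassmann"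
  assumes "near_id \<sigma>" "a \<in> components D" "upclosed D"
  shows "inv_into UNIV \<sigma> a \<in> components D"
proof -
  obtain b where "b \<in> components D" "\<sigma> b = a"
    using near_id_surj_components[OF assms(1,3,2)] by blast
  moreover have "inv_into UNIV \<sigma> (\<sigma> b) = b"
    using near_id_bij[OF assms(1)] by (simp add: bij_is_inj inv_f_f)
  ultimately show ?thesis by simp
qed

lemma near_id_id: "near_id id"
  by (simp add: ghom_def glinear_def)

lemma near_id_comp:
  assumes "near_id \<sigma>" "near_id \<tau>"
  shows "near_id (\<sigma> \<circ> \<tau>)"
proof (intro conjI allI)
  show "ghom (\<sigma> \<circ> \<tau>)"
    using assms by (simp add: ghom_def glinear_def)
  fix i
  have "\<sigma> (\<tau> (gen i) - gen i) \<in> components {d. odd d \<and> 3 \<le> d}"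
    by (rule near_id_components[OF assms(1)]) (use assms(2) in \<open>auto simp: upclosed_def\<close>)
  moreover have "\<sigma> (gen i) - gen i \<in> components {d. odd d \<and> 3 \<le> d}"
    using assms by blast
  ultimately have "\<sigma> (\<tau> (gen i) - gen i) + (\<sigma> (gen i) - gen i) \<in> components {d. odd d \<and> 3 \<le> d}"
    by (rule components_add)
  then show "(\<sigma> \<circ> \<tau>) (gen i) - gen i \<in> components {d. odd d \<and> 3 \<le> d}"
    using assms glinear_diff[OF ghom_linear, of \<sigma>] by simp
qed

lemma near_id_inv:
  fixes \<sigma> :: "('k::comm_ring_1, 'n::{finite,linorder}) grassmann \<Rightarrow> ('k, 'n) grassmann"
  assumes "near_id \<sigma>"
  shows "near_id (inv_into UNIV \<sigma>)"
proof (intro conjI allI)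
  have bij: "bij \<sigma>" by (rule near_id_bij[OF assms])
  then have [simp]: "\<sigma> (inv_into UNIV \<sigma> a) = a" "inv_into UNIV \<sigma> (\<sigma> a) = a" for a
    by (simp_all add: bij_is_inj bij_is_surj surj_f_inv_f)
  have inj: "a = b" if "\<sigma> a = \<sigma> b" for a b
    using bij that by (simp add: bij_def inj_def)
  have hom: "ghom \<sigma>" using assms by blast
  show "ghom (inv_into UNIV \<sigma>)"
    unfolding ghom_def glinear_def
    by (intro conjI allI; rule inj)
      (simp_all add: ghom_one[OF hom] ghom_mult[OF hom] glinear_add[OF ghom_linear[OF hom]]
        glinear_scale[OF ghom_linear[OF hom]])
  fix i
  \<comment> \<open>Up to sign this is the displacement of \<open>gen i\<close> under the
    inverse.\<close>
  have "inv_into UNIV \<sigma> (\<sigma> (gen i) - gen i) \<in> components {d. odd d \<and> 3 \<le> d}"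
    by (rule near_id_inv_components[OF assms]) (use assms in \<open>auto simp: upclosed_def\<close>)
  then have "- inv_into UNIV \<sigma> (\<sigma> (gen i) - gen i) \<in> components {d. odd d \<and> 3 \<le> d}"
    by (rule components_uminus)
  then show "inv_into UNIV \<sigma> (gen i) - gen i \<in> components {d. odd d \<and> 3 \<le> d}"
    using glinear_diff[OF ghom_linear[OF \<open>ghom (inv_into UNIV \<sigma>)\<close>]] by simp
qed

lemma near_id_inv_comp:
  fixes \<sigma> :: "('k::comm_ring_1, 'n::{finite,linorder}) grassmann \<Rightarrow> ('k, 'n) grassmann"
  assumes "near_id \<sigma>"
  shows "inv_into UNIV \<sigma> \<circ> \<sigma> = id" "\<sigma> \<circ> inv_into UNIV \<sigma> = id"
  using near_id_bij[OF assms] by (auto simp: bij_is_inj bij_is_surj surj_f_inv_f fun_eq_iff)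

lemma group_Gamma_group:
  "group (Gamma_group :: (('k::comm_ring_1, 'n::{finite,linorder}) grassmann \<Rightarrow> ('k, 'n) grassmann) monoid)"
  unfolding Gamma_group_def Gamma_eq
proof (rule groupI; simp only: partial_object.simps monoid.simps mem_Collect_eq)
  show "\<exists>\<tau>\<in>{\<sigma>. near_id \<sigma>}. \<tau> \<circ> \<sigma> = id"
    if "near_id \<sigma>" for \<sigma> :: "('k, 'n) grassmann \<Rightarrow> ('k, 'n) grassmann"
    using near_id_inv[OF that] near_id_inv_comp[OF that] by blast
qed (rule near_id_id near_id_comp comp_assoc id_comp; assumption?)+

section \<open>Determinants of matrices with even entries\<close>

text \<open>The even part is commutative; as a type of class \<open>comm_ring_1\<close> it gives
  access to \<open>det_mul\<close>.\<close>

typedef (overloaded) ('k, 'n) even_grassmann =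
  "components {d. even d} :: ('k::comm_ring_1, 'n) grassmann set"
  using components_zero by blast

setup_lifting type_definition_even_grassmann

instantiation even_grassmann :: (comm_ring_1, type) comm_ring_1
begin

lift_definition zero_even_grassmann :: "('a, 'b) even_grassmann" is 0
  by simp
lift_definition one_even_grassmann :: "('a, 'b) even_grassmann" is 1
  by (simp add: components_one)
lift_definition plus_even_grassmann ::
  "('a, 'b) even_grassmann \<Rightarrow> ('a, 'b) even_grassmann \<Rightarrow> ('a, 'b) even_grassmann" is "(+)"
  by (rule components_add)
lift_definition uminus_even_grassmann :: "('a, 'b) even_grassmann \<Rightarrow> ('a, 'b) even_grassmann" is uminus
  by (rule components_uminus)
lift_definition minus_even_grassmann ::
  "('a, 'b) even_grassmann \<Rightarrow> ('a, 'b) even_grassmann \<Rightarrow> ('a, 'b) even_grassmann" is "(-)"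
  by (rule components_diff)
lift_definition times_even_grassmann ::
  "('a, 'b) even_grassmann \<Rightarrow> ('a, 'b) even_grassmann \<Rightarrow> ('a, 'b) even_grassmann" is "(*)"
  by (erule (1) components_mult) simp

instance
  by standard (transfer; simp add: algebra_simps even_components_commute; fail)+

end

text \<open>Applied below to the inclusion of the even part, to the augmentation and to an
  automorphism \<sigma>.\<close>

lemma leibniz_det_hom:
  fixes f :: "'r::ring_1 \<Rightarrow> 's::ring_1"
  assumes one: "f 1 = 1" and add: "\<And>a b. f (a + b) = f a + f b" and mult: "\<And>a b. f (a * b) = f a * f b"
  shows "f (leibniz_det A) = leibniz_det (\<lambda>i j. f (A i j))"
proof -
  have zero: "f 0 = 0" using add[of 0 0] by simp
  have uminus: "f (- a) = - f a" for a using add[of "- a" a] zero by (simp add: eq_neg_iff_add_eq_0)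
  have sum: "f (\<Sum>i\<in>I. g i) = (\<Sum>i\<in>I. f (g i))" for I :: "'c set" and g
    by (induction I rule: infinite_finite_induct) (auto simp: zero add)
  have prod: "f (prod_list xs) = prod_list (map f xs)" for xs
    by (induction xs) (auto simp: one mult)
  show ?thesis
    unfolding leibniz_det_def sum
    by (rule sum.cong) (simp_all add: mult prod sign_def one uminus comp_def)
qed

lemma leibniz_det_eq_det:
  fixes A :: "'n::{finite,linorder} \<Rightarrow> 'n \<Rightarrow> 'r::comm_ring_1"
  shows "leibniz_det A = det (\<chi> i j. A i j)"
proof -
  have "prod_list (map f (sorted_list_of_set UNIV)) = prod f UNIV" for f :: "'n \<Rightarrow> 'r"
    using prod.distinct_set_conv_list[of "sorted_list_of_set (UNIV :: 'n set)" f] by simp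
  then show ?thesis by (simp add: leibniz_det_def det_def)
qed

text \<open>The entries are pulled back to \<open>even_grassmann\<close>, where
  \<open>det_mul\<close> applies, and the result is pushed forward along the inclusion.\<close>

lemma leibniz_det_mult:
  fixes A B :: "'n::{finite,linorder} \<Rightarrow> 'n \<Rightarrow> ('k::comm_ring_1, 'm) grassmann"
  assumes A: "\<And>i j. A i j \<in> components {d. even d}" and B: "\<And>i j. B i j \<in> components {d. even d}"
  shows "leibniz_det (\<lambda>i j. \<Sum>l\<in>UNIV. A i l * B l j) = leibniz_det A * leibniz_det B"
    and "leibniz_det A \<in> components {d. even d}"
proof -
  define A' where "A' = (\<lambda>i j. Abs_even_grassmann (A i j))"
  define B' where "B' = (\<lambda>i j. Abs_even_grassmann (B i j))"
  have AB: "A = (\<lambda>i j. Rep_even_grassmann (A' i j))" "B = (\<lambda>i j. Rep_even_grassmann (B' i j))"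
    using A B by (simp_all add: A'_def B'_def Abs_even_grassmann_inverse)
  note hom = leibniz_det_hom[of Rep_even_grassmann, OF one_even_grassmann.rep_eq
      plus_even_grassmann.rep_eq times_even_grassmann.rep_eq, symmetric]
  have sum: "Rep_even_grassmann (\<Sum>l\<in>I. f l) = (\<Sum>l\<in>I. Rep_even_grassmann (f l))"
    for I :: "'n set" and f :: "'n \<Rightarrow> ('k, 'm) even_grassmann"
    by (induction I rule: infinite_finite_induct)
      (simp_all add: zero_even_grassmann.rep_eq plus_even_grassmann.rep_eq)
  have "leibniz_det (\<lambda>i j. \<Sum>l\<in>UNIV. A' i l * B' l j) = leibniz_det A' * leibniz_det B'"
    unfolding leibniz_det_eq_det det_mul[symmetric] matrix_matrix_mult_def by simp
  then show "leibniz_det (\<lambda>i j. \<Sum>l\<in>UNIV. A i l * B l j) = leibniz_det A * leibniz_det B"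
    unfolding AB hom by (simp add: hom flip: sum times_even_grassmann.rep_eq)
  show "leibniz_det A \<in> components {d. even d}"
    unfolding AB hom by (rule Rep_even_grassmann)
qed

text \<open>A permutation other than the identity moves at least two points, hence one different
  from \<open>k\<close>, and the row there contributes a factor 0.\<close>

lemma leibniz_det_single_row:
  fixes A :: "'n::{finite,linorder} \<Rightarrow> 'n \<Rightarrow> 'r::ring_1"
  assumes A: "\<And>i j. i \<noteq> k \<Longrightarrow> A i j = (if i = j then 1 else 0)"
  shows "leibniz_det A = A k k"
proof -
  let ?xs = "sorted_list_of_set (UNIV :: 'n set)"
  have zero: "prod_list (map (\<lambda>i. A i (p i)) ?xs) = 0" if p: "p permutes UNIV" "p \<noteq> id" for p
  proof -
    obtain i where "p i \<noteq> i" using p(2) by (auto simp: fun_eq_iff)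
    then have "\<exists>i. i \<noteq> k \<and> p i \<noteq> i"
      using permutes_inj[OF p(1)] by (metis injD)
    then obtain i where "i \<noteq> k" "p i \<noteq> i" by blast
    then have "A i (p i) = 0" using A[of i "p i"] by auto
    then have "0 \<in> set (map (\<lambda>i. A i (p i)) ?xs)"
      by (auto simp: image_iff intro!: exI[of _ i])
    moreover have "0 \<in> set xs \<Longrightarrow> prod_list xs = 0" for xs :: "'r list"
      by (induction xs) auto
    ultimately show ?thesis by blast
  qed
  have diag: "prod_list (map f xs) = (if k \<in> set xs then f k else 1)"
    if "distinct xs" "\<And>i. i \<noteq> k \<Longrightarrow> f i = 1" for f :: "'n \<Rightarrow> 'r" and xs
    using that(1)
  proof (induction xs)
    case (Cons i xs)
    then show ?case using that(2)[of i] by (cases "i = k") auto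
  qed simp
  have "leibniz_det A = (\<Sum>p\<in>{id}. of_int (sign p) * prod_list (map (\<lambda>i. A i (p i)) ?xs))"
    unfolding leibniz_det_def
    by (rule sum.mono_neutral_right) (auto simp: permutes_id zero)
  also have "\<dots> = A k k"
    using diag[of ?xs "\<lambda>i. A i i"] A by (simp add: sign_id)
  finally show ?thesis .
qed

section \<open>The Jacobian\<close>

lemma jacobian_eq: "jacobian \<sigma> = leibniz_det (\<lambda>i j. pd j (\<sigma> (gen i)))"
  by (simp add: jacobian_def skew_partial_eq)

lemma near_id_pd_even:
  assumes "near_id \<sigma>"
  shows "pd j (\<sigma> (gen i)) \<in> components {d. even d}"
  using near_id_gen_odd[OF assms] by (rule pd_components) simp

text \<open>Induction on words: the odd element \<open>\<sigma> (gen i)\<close> supplies the sign of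
  the Leibniz rule, and the entries of the Jacobian matrix are even, hence central.\<close>

lemma chain_rule:
  fixes \<sigma> :: "('k::comm_ring_1, 'n::finite) grassmann \<Rightarrow> ('k, 'n) grassmann"
  assumes "near_id \<sigma>"
  shows "pd j (\<sigma> a) = (\<Sum>l\<in>UNIV. pd j (\<sigma> (gen l)) * \<sigma> (pd l a))"
proof -
  have hom: "ghom \<sigma>" using assms by blast
  note lin = glinear_add[OF glinear_pd] glinear_scale[OF glinear_pd] glinear_add[OF ghom_linear[OF hom]]
    glinear_scale[OF ghom_linear[OF hom]] glinear_diff[OF ghom_linear[OF hom]] glinear_zero[OF ghom_linear[OF hom]]
  show ?thesis
  proof (induction a rule: grassmann_induct)
    case (word w)
    show ?case
    proof (induction w)
      case Nil
      show ?case by (simp add: ghom_one[OF hom] pd_one lin)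
    next
      case (Cons i w)
      have commute: "\<sigma> (gen i) * (pd j (\<sigma> (gen l)) * b) = pd j (\<sigma> (gen l)) * (\<sigma> (gen i) * b)" for l b
        using even_components_commute[OF near_id_pd_even[OF assms]] by (metis mult.assoc)
      have "pd j (\<sigma> (gword (i # w))) =
          pd j (\<sigma> (gen i)) * \<sigma> (gword w) - \<sigma> (gen i) * pd j (\<sigma> (gword w))"
        by (simp add: ghom_mult[OF hom] pd_mult parity_odd[OF near_id_gen_odd[OF assms]])
      also have "\<dots> = (\<Sum>l\<in>UNIV. pd j (\<sigma> (gen l)) * (if l = i then \<sigma> (gword w) else 0))
          - (\<Sum>l\<in>UNIV. pd j (\<sigma> (gen l)) * (\<sigma> (gen i) * \<sigma> (pd l (gword w))))"
        unfolding Cons by (simp add: sum_distrib_left commute if_distrib[of "\<lambda>x. _ * x"] cong: if_cong)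
      also have "\<dots> = (\<Sum>l\<in>UNIV. pd j (\<sigma> (gen l)) * \<sigma> (pd l (gword (i # w))))"
        unfolding sum_subtractf[symmetric]
        by (rule sum.cong)
          (auto simp: pd_mult pd_gen parity_gen lin ghom_mult[OF hom] right_diff_distrib
            glinear_uminus[OF ghom_linear[OF hom]] ghom_one[OF hom])
      finally show ?case .
    qed
  qed (simp_all add: lin distrib_left sum.distrib scale_mult_right grassmann.scale_sum_right)
qed

lemma jacobian_id: "jacobian id = (1 :: ('k::comm_ring_1, 'n::{finite,linorder}) grassmann)"
proof -
  have "leibniz_det (\<lambda>i j. pd j (gen i)) = (pd k (gen k) :: ('k, 'n) grassmann)" for k :: 'n
    by (rule leibniz_det_single_row) (auto simp: pd_gen)
  then show ?thesis by (simp add: jacobian_eq pd_gen)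
qed

context
  fixes \<sigma> :: "('k::comm_ring_1, 'n::{finite,linorder}) grassmann \<Rightarrow> ('k, 'n) grassmann"
  assumes \<sigma>: "near_id \<sigma>"
begin

lemma jacobian_even: "jacobian \<sigma> \<in> components {d. even d}"
  unfolding jacobian_eq by (rule leibniz_det_mult(2); rule near_id_pd_even[OF \<sigma>])

text \<open>Modulo the augmentation ideal the Jacobian matrix is the identity.\<close>

lemma aug_jacobian: "aug (jacobian \<sigma>) = 1"
proof -
  have entry: "aug (pd j (\<sigma> (gen i))) = (if i = j then 1 else 0)" for i j
  proof -
    \<comment> \<open>The displacement has degree at least 3, so its derivative has no constant
      term.\<close>
    have "pd j (\<sigma> (gen i) - gen i) \<in> components {1..}"
      by (rule pd_components[where D = "{d. odd d \<and> 3 \<le> d}"]) (use \<sigma> in auto)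
    then have "coeff {} (pd j (\<sigma> (gen i) - gen i)) = 0"
      unfolding components_eq_coeff by force
    then show ?thesis
      by (simp add: coeff_empty glinear_diff[OF glinear_pd] pd_gen aug_diff split: if_splits)
  qed
  have "aug (jacobian \<sigma>) = leibniz_det (\<lambda>i j :: 'n. if i = j then 1 else 0)"
    unfolding jacobian_eq by (subst leibniz_det_hom[of aug]) (simp_all add: aug_add aug_mult entry)
  then show ?thesis
    \<comment> \<open>Any row of the identity matrix may serve as the exceptional one, hence
      \<open>undefined\<close>.\<close>
    using leibniz_det_single_row[of undefined "\<lambda>i j :: 'n. if i = j then 1 else 0 :: 'k"] by simp
qed

lemma jacobian_minus_one: "jacobian \<sigma> - 1 \<in> components {d. even d \<and> 2 \<le> d}"
proof -
  let ?a = "jacobian \<sigma> - 1"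
  have "?a \<in> components {d. even d}"
    by (intro components_diff jacobian_even components_one) simp
  then have even: "coeff S ?a \<noteq> 0 \<Longrightarrow> even (card S)" for S
    unfolding components_eq_coeff by blast
  have "coeff {} ?a = 0"
    using aug_jacobian aug_add[of ?a 1] by (simp add: coeff_empty)
  then have "coeff S ?a \<noteq> 0 \<Longrightarrow> card S \<noteq> 0" for S
    by auto
  moreover have "2 \<le> d" if "even d" "d \<noteq> 0" for d :: nat
    using that by (auto elim!: evenE)
  ultimately show ?thesis
    using even unfolding components_eq_coeff by blast
qed

lemma jacobian_comp:
  assumes \<tau>: "near_id \<tau>"
  shows "jacobian (\<sigma> \<circ> \<tau>) = jacobian \<sigma> * \<sigma> (jacobian \<tau>)"
proof -
  have hom: "ghom \<sigma>" using \<sigma> by blast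
  have even: "\<sigma> (pd j (\<tau> (gen i))) \<in> components {d. even d}" for i j
    by (intro near_id_components[OF \<sigma>] near_id_pd_even[OF \<tau>]) (auto simp: upclosed_def)
  \<comment> \<open>The chain rule puts the entries of \<sigma> first; as they are central, the
    factors can be swapped into a matrix product whose rows come from \<tau>.\<close>
  have "jacobian (\<sigma> \<circ> \<tau>) =
      leibniz_det (\<lambda>i j. \<Sum>l\<in>UNIV. \<sigma> (pd l (\<tau> (gen i))) * pd j (\<sigma> (gen l)))"
    unfolding jacobian_eq comp_def chain_rule[OF \<sigma>, of _ "\<tau> _"]
    by (simp add: even_components_commute[OF near_id_pd_even[OF \<sigma>]])
  also have "\<dots> = leibniz_det (\<lambda>i j. \<sigma> (pd j (\<tau> (gen i)))) * jacobian \<sigma>"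
    unfolding jacobian_eq by (rule leibniz_det_mult(1)) (rule even near_id_pd_even[OF \<sigma>])+
  also have "leibniz_det (\<lambda>i j. \<sigma> (pd j (\<tau> (gen i)))) = \<sigma> (jacobian \<tau>)"
    unfolding jacobian_eq
    by (rule leibniz_det_hom[symmetric])
      (simp_all add: ghom_one[OF hom] ghom_mult[OF hom] glinear_add[OF ghom_linear[OF hom]])
  also have "\<sigma> (jacobian \<tau>) * jacobian \<sigma> = jacobian \<sigma> * \<sigma> (jacobian \<tau>)"
    by (simp add: even_components_commute[OF jacobian_even])
  finally show ?thesis .
qed

end

section \<open>The Jacobian ascents are subgroups\<close>

abbreviation ascent_degrees :: "nat \<Rightarrow> nat set" where
  "ascent_degrees k \<equiv> {d. even d \<and> 2 \<le> d \<and> k \<le> d}"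

lemma E'_iff:
  fixes u :: "('k::comm_ring_1, 'n::{finite,linorder}) grassmann"
  shows "u \<in> E' k \<longleftrightarrow> u - 1 \<in> components (ascent_degrees k)"
proof -
  have plus_image: "u \<in> (+) 1 ` A \<longleftrightarrow> u - 1 \<in> A" for A :: "('k, 'n) grassmann set"
    by (auto simp: image_iff intro!: bexI[of _ "u - 1"])
  have "components {d. even d \<and> 2 \<le> d} \<inter> components {k..} =
      (components (ascent_degrees k) :: ('k, 'n) grassmann set)"
    unfolding components_Int by (rule arg_cong[of _ _ components]) auto
  then show ?thesis
    unfolding E'_def max_ideal_power_eq by (auto simp: plus_image)
qed

lemma Jacobian_ascent_iff:
  "\<sigma> \<in> Jacobian_ascent k \<longleftrightarrow> near_id \<sigma> \<and> jacobian \<sigma> - 1 \<in> components (ascent_degrees k)"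
  by (auto simp: Jacobian_ascent_def Gamma_eq E'_iff)

lemma Jacobian_ascent_antimono: "k \<le> l \<Longrightarrow> Jacobian_ascent l \<subseteq> Jacobian_ascent k"
  unfolding Jacobian_ascent_iff subset_iff
  by (auto elim!: subsetD[OF components_mono, rotated])

lemma Jacobian_ascent_2: "Jacobian_ascent 2 = Gamma"
  by (simp add: set_eq_iff Jacobian_ascent_iff Gamma_eq) (blast intro: jacobian_minus_one)

lemma Jacobian_ascent_above_card:
  assumes "card (UNIV :: 'n set) < k"
  shows "Jacobian_ascent k = (Jacobian_group :: (('k::comm_ring_1, 'n::{finite,linorder}) grassmann \<Rightarrow> _) set)"
proof -
  have "u = 0" if "u \<in> components (ascent_degrees k)" for u :: "('k, 'n) grassmann"
    by (rule components_above_card) (rule subsetD[OF components_mono that], use assms in auto)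
  from this[of "_ - 1"] have "u - 1 \<in> components (ascent_degrees k) \<longleftrightarrow> u = 1"
    for u :: "('k, 'n) grassmann"
    by auto
  then show ?thesis
    by (simp add: set_eq_iff Jacobian_ascent_iff Jacobian_group_def Gamma_eq)
qed

text \<open>Rests on \<open>a * b - 1 = (a - 1) * (b - 1) + (a - 1) + (b - 1)\<close>.\<close>

lemma even_one_plus_mult:
  assumes "a - 1 \<in> components (ascent_degrees k)" "b - 1 \<in> components (ascent_degrees k)"
  shows "a * b - 1 \<in> components (ascent_degrees k)"
proof -
  have "(a - 1) * (b - 1) \<in> components (ascent_degrees k)"
    by (rule components_mult[OF assms]) auto
  then have "(a - 1) * (b - 1) + (a - 1) + (b - 1) \<in> components (ascent_degrees k)"
    using assms by (intro components_add)
  then show ?thesis by (simp add: algebra_simps)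
qed

text \<open>Rests on \<open>b - 1 = - (b * (a - 1))\<close>; the even factor \<open>b\<close> keeps
  the parity and cannot lower the degree.\<close>

lemma even_one_plus_inverse:
  assumes "a - 1 \<in> components (ascent_degrees k)" "b \<in> components {d. even d}" "b * a = 1"
  shows "b - 1 \<in> components (ascent_degrees k)"
proof -
  have "b * (a - 1) \<in> components (ascent_degrees k)"
    by (rule components_mult[OF assms(2,1)]) auto
  from components_uminus[OF this] show ?thesis
    using assms(3) by (simp add: algebra_simps)
qed

lemma upclosed_ascent_degrees: "upclosed (ascent_degrees k)"
  by (auto simp: upclosed_def)

lemma ghom_minus_one: "ghom \<sigma> \<Longrightarrow> \<sigma> a - 1 = \<sigma> (a - 1)"
  by (simp add: glinear_diff ghom_linear ghom_one)

text \<open>The cocycle identity for the two composites equal to \<open>id\<close>. The second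
  equation shows that the Jacobian is a unit and names its inverse.\<close>

lemma jacobian_inverse:
  fixes \<sigma> :: "('k::comm_ring_1, 'n::{finite,linorder}) grassmann \<Rightarrow> ('k, 'n) grassmann"
  assumes "near_id \<sigma>"
  shows "jacobian (inv_into UNIV \<sigma>) * inv_into UNIV \<sigma> (jacobian \<sigma>) = 1"
    and "\<sigma> (jacobian (inv_into UNIV \<sigma>)) * jacobian \<sigma> = 1"
  using jacobian_comp[OF near_id_inv[OF assms] assms] jacobian_comp[OF assms near_id_inv[OF assms]]
    even_components_commute[OF jacobian_even[OF assms]]
  by (simp_all add: near_id_inv_comp[OF assms] jacobian_id)

lemma subgroup_Jacobian_ascent:
  "subgroup (Jacobian_ascent k)
    (Gamma_group :: (('k::comm_ring_1, 'n::{finite,linorder}) grassmann \<Rightarrow> ('k, 'n) grassmann) monoid)"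
proof (rule group.subgroupI[OF group_Gamma_group])
  show "Jacobian_ascent k \<subseteq> carrier (Gamma_group :: (('k, 'n) grassmann \<Rightarrow> _) monoid)"
    by (auto simp: Jacobian_ascent_def Gamma_group_def)
  have "id \<in> (Jacobian_ascent k :: (('k, 'n) grassmann \<Rightarrow> ('k, 'n) grassmann) set)"
    unfolding Jacobian_ascent_iff jacobian_id using near_id_id by simp
  then show "Jacobian_ascent k \<noteq> ({} :: (('k, 'n) grassmann \<Rightarrow> ('k, 'n) grassmann) set)"
    by blast
next
  fix \<sigma> :: "('k, 'n) grassmann \<Rightarrow> ('k, 'n) grassmann"
  assume "\<sigma> \<in> Jacobian_ascent k"
  then have \<sigma>: "near_id \<sigma>" and J: "jacobian \<sigma> - 1 \<in> components (ascent_degrees k)"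
    by (simp_all add: Jacobian_ascent_iff)
  let ?\<tau> = "inv_into UNIV \<sigma>"
  note inv = near_id_inv[OF \<sigma>]
  have "inv\<^bsub>Gamma_group\<^esub> \<sigma> = ?\<tau>"
    by (rule group.inv_equality[OF group_Gamma_group])
      (simp_all only: Gamma_group_def Gamma_eq partial_object.simps monoid.simps mem_Collect_eq
        near_id_inv_comp[OF \<sigma>] inv \<sigma> simp_thms)
  \<comment> \<open>By \<open>jacobian_inverse\<close> the Jacobian of \<open>?\<tau>\<close> is
    inverse to \<open>?\<tau> (jacobian \<sigma>)\<close>, so a degree bound for the latter
    suffices.\<close>
  moreover have "?\<tau> (jacobian \<sigma>) - 1 \<in> components (ascent_degrees k)"
    using inv by (subst ghom_minus_one)
      (blast, rule near_id_inv_components[OF \<sigma> J upclosed_ascent_degrees])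
  then have "jacobian ?\<tau> - 1 \<in> components (ascent_degrees k)"
    using jacobian_even[OF inv] jacobian_inverse(1)[OF \<sigma>] by (rule even_one_plus_inverse)
  ultimately show "inv\<^bsub>Gamma_group\<^esub> \<sigma> \<in> Jacobian_ascent k"
    using inv by (simp only: Jacobian_ascent_iff simp_thms)
next
  fix \<sigma> \<tau> :: "('k, 'n) grassmann \<Rightarrow> ('k, 'n) grassmann"
  assume "\<sigma> \<in> Jacobian_ascent k" "\<tau> \<in> Jacobian_ascent k"
  then have \<sigma>: "near_id \<sigma>" "jacobian \<sigma> - 1 \<in> components (ascent_degrees k)"
    and \<tau>: "near_id \<tau>" "jacobian \<tau> - 1 \<in> components (ascent_degrees k)"
    by (simp_all only: Jacobian_ascent_iff simp_thms)
  have "\<sigma> (jacobian \<tau>) - 1 \<in> components (ascent_degrees k)"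
    using \<sigma>(1) by (subst ghom_minus_one)
      (blast, rule near_id_components[OF \<sigma>(1) \<tau>(2) upclosed_ascent_degrees])
  then have "jacobian (\<sigma> \<circ> \<tau>) - 1 \<in> components (ascent_degrees k)"
    unfolding jacobian_comp[OF \<sigma>(1) \<tau>(1)] using \<sigma>(2) by (intro even_one_plus_mult)
  with near_id_comp[OF \<sigma>(1) \<tau>(1)] have "\<sigma> \<circ> \<tau> \<in> Jacobian_ascent k"
    by (simp only: Jacobian_ascent_iff simp_thms)
  then show "\<sigma> \<otimes>\<^bsub>Gamma_group\<^esub> \<tau> \<in> Jacobian_ascent k"
    by (simp add: Gamma_group_def)
qed

section \<open>Automorphisms moving a single generator\<close>

text \<open>The prescribed images are odd, so they square to 0 and anticommute, as the universal
  property demands.\<close>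

lemma elementary_automorphism:
  fixes y :: "('k::comm_ring_1, 'n::{finite,linorder}) grassmann"
  assumes "y - gen k \<in> components {d. odd d \<and> 3 \<le> d}"
  shows "\<exists>\<rho>. near_id \<rho> \<and> \<rho> (gen k) = y \<and> (\<forall>i. i \<noteq> k \<longrightarrow> \<rho> (gen i) = gen i)"
proof -
  let ?y = "gen(k := y)"
  have "y - gen k + gen k \<in> components {d. odd d}"
    by (intro components_add components_gen subsetD[OF components_mono assms]) auto
  then have odd: "?y i \<in> components {d. odd d}" for i
    by (auto intro: components_gen)
  have sq: "?y i * ?y i = 0" for i
    by (rule odd_components_square[OF odd])
  have anti: "?y i * ?y j + ?y j * ?y i = 0" for i j
    using odd_components_anticommute[OF odd[of i] odd[of j]] unfolding eq_neg_iff_add_eq_0 .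
  note hom = ghom_hom_of[of ?y, OF sq anti] and gen = hom_of_gen[of ?y, OF sq anti]
  show ?thesis
    by (rule exI[of _ "hom_of ?y"]) (use hom assms in \<open>auto simp: gen\<close>)
qed

lemma jacobian_elementary:
  fixes \<rho> :: "('k::comm_ring_1, 'n::{finite,linorder}) grassmann \<Rightarrow> ('k, 'n) grassmann"
  assumes "\<And>i. i \<noteq> k \<Longrightarrow> \<rho> (gen i) = gen i"
  shows "jacobian \<rho> = pd k (\<rho> (gen k))"
  unfolding jacobian_eq by (rule leibniz_det_single_row) (auto simp: assms pd_gen)

lemma Jacobian_ascent_strict:
  assumes "1 \<le> m" "2 * m < card (UNIV :: 'n::{finite,linorder} set)"
  shows "Jacobian_ascent (2 * m + 2) \<subset>
    (Jacobian_ascent (2 * m) :: (('k::comm_ring_1, 'n) grassmann \<Rightarrow> ('k, 'n) grassmann) set)"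
proof -
  \<comment> \<open>A set of size \<open>2 * m + 1\<close> supplies both \<open>S\<close> and a
    generator \<open>k\<close> outside it; this is where the strict bound on \<open>2 * m\<close>
    enters.\<close>
  obtain S' :: "'n set" where "card S' = Suc (2 * m)"
    using obtain_subset_with_card_n[of "Suc (2 * m)" "UNIV :: 'n set"] assms(2) by auto
  then obtain k S where k: "k \<notin> S" and S: "card S = 2 * m" and "S' = insert k S"
    by (auto simp: card_Suc_eq)
  let ?y = "gen k + gen k * monomial S :: ('k, 'n) grassmann"
  have "gen k * monomial S \<in> components {d. odd d \<and> 3 \<le> d}"
    by (rule components_mult[OF components_gen[of "{1}"] components_gword[of _ "{2 * m}"]])
      (use S assms(1) in auto)
  then have "?y - gen k \<in> components {d. odd d \<and> 3 \<le> d}" by simp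
  then obtain \<rho> where \<rho>: "near_id \<rho>" "\<rho> (gen k) = ?y" "\<forall>i. i \<noteq> k \<longrightarrow> \<rho> (gen i) = gen i"
    using elementary_automorphism by blast
  \<comment> \<open>Hence the derivative of \<open>gen k * monomial S\<close> by
    \<open>gen k\<close> is \<open>monomial S\<close>, without sign.\<close>
  have "pd k (monomial S :: ('k, 'n) grassmann) = 0"
    unfolding pd_gword using k by (intro partial_word_notin) simp
  then have "jacobian \<rho> - 1 = monomial S"
    using jacobian_elementary[of k \<rho>] \<rho>(3)
    by (simp add: \<rho>(2) glinear_add[OF glinear_pd] pd_gen pd_mult)
  moreover have "monomial S \<in> components (ascent_degrees (2 * m))"
    using S assms(1) by (intro components_gword) simp
  moreover have "monomial S \<notin> (components (ascent_degrees (2 * m + 2)) :: ('k, 'n) grassmann set)"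
  proof
    assume "monomial S \<in> (components (ascent_degrees (2 * m + 2)) :: ('k, 'n) grassmann set)"
    moreover have "coeff S (monomial S :: ('k, 'n) grassmann) \<noteq> 0"
      by (simp add: coeff_monomial)
    ultimately have "card S \<in> ascent_degrees (2 * m + 2)"
      unfolding components_eq_coeff by blast
    with S show False by simp
  qed
  ultimately have "\<rho> \<in> Jacobian_ascent (2 * m)" "\<rho> \<notin> Jacobian_ascent (2 * m + 2)"
    using \<rho>(1) by (simp_all only: Jacobian_ascent_iff simp_thms)
  with Jacobian_ascent_antimono[of "2 * m" "2 * m + 2"] show ?thesis by auto
qed

section \<open>Change of variables in the Berezin integral\<close>

text \<open>The image of \<open>pd k\<close> is spanned by the words that avoid
  \<open>k\<close>.\<close>

lemma pd_induct [case_names word zero add scale]: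
  fixes a :: "('k::comm_ring_1, 'n) grassmann"
  assumes word: "\<And>w. k \<notin> set w \<Longrightarrow> P (gword w)" and zero: "P 0"
    and add: "\<And>a b. P a \<Longrightarrow> P b \<Longrightarrow> P (a + b)" and scale: "\<And>c a. P a \<Longrightarrow> P (scale c a)"
  shows "P (pd k a)"
proof (induction a rule: grassmann_induct)
  case (word w)
  show ?case
  proof (cases "distinct w \<and> k \<in> set w")
    case True
    then obtain e where "partial_word k w = scale e (gword (remove1 k w) :: ('k, 'n) grassmann)"
      using partial_word_distinct[of w k] by metis
    with True show ?thesis by (simp add: pd_gword scale assms(1))
  next
    case False
    then have "pd k (gword w :: ('k, 'n) grassmann) = 0"
      using gword_not_distinct[of w, where 'k = 'k]
      by (cases "distinct w") (simp add: pd_gword partial_word_notin, simp add: glinear_zero[OF glinear_pd])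
    with zero show ?thesis by simp
  qed
qed (simp_all add: glinear_add[OF glinear_pd] glinear_scale[OF glinear_pd] add scale)

lemma pd_pd: "pd k (pd k a) = 0"
  by (induction a rule: pd_induct[of k "\<lambda>a. pd k a = 0"])
    (simp_all add: pd_gword partial_word_notin glinear_zero[OF glinear_pd]
      glinear_add[OF glinear_pd] glinear_scale[OF glinear_pd])

text \<open>A derivative by \<open>gen k\<close> involves only the other generators, all of which
  \<rho> fixes.\<close>

lemma ghom_fixes_pd:
  assumes "ghom \<rho>" "\<And>i. i \<noteq> k \<Longrightarrow> \<rho> (gen i) = gen i"
  shows "\<rho> (pd k a) = pd k a"
proof (induction a rule: pd_induct)
  case (word w)
  then have "map (\<lambda>i. \<rho> (gen i)) w = map gen w"
    by (intro map_cong refl assms(2)) auto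
  then show ?case by (simp only: ghom_gword[OF assms(1)])
qed (simp_all add: glinear_zero glinear_add glinear_scale ghom_linear[OF assms(1)])

text \<open>The two arguments differ by \<open>pd k (gen k * a)\<close>, and a derivative has no
  component in top degree. Thus the integral depends only on \<open>pd k a\<close>.\<close>

lemma coeff_UNIV_eq:
  fixes a :: "('k::comm_ring_1, 'n::{finite,linorder}) grassmann"
  shows "coeff UNIV a = coeff UNIV (gen k * pd k a)"
proof -
  have "gen k * a \<in> components {..card (UNIV :: 'n set)}"
    unfolding components_eq_coeff by (auto intro: card_mono)
  then have "pd k (gen k * a) \<in> components {..<card (UNIV :: 'n set)}"
    by (rule pd_components) simp
  then have "coeff UNIV (pd k (gen k * a)) = 0"
    unfolding components_eq_coeff by blast
  then show ?thesis
    by (simp add: pd_mult pd_gen parity_gen coeff_diff)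
qed

text \<open>With \<open>coeff UNIV\<close> as the Berezin integral, this says that \<open>\<integral>\<sigma>(f) J(\<sigma>)\<inverse> = \<integral>f\<close>.\<close>

definition berezin :: "(('k::comm_ring_1, 'n::{finite,linorder}) grassmann \<Rightarrow> ('k, 'n) grassmann) \<Rightarrow> bool" where
  "berezin \<sigma> \<longleftrightarrow> (\<forall>f g. \<sigma> f = jacobian \<sigma> * g \<longrightarrow> coeff UNIV g = coeff UNIV f)"

text \<open>Differentiating \<open>\<rho> f = jacobian \<rho> * g\<close> by \<open>gen k\<close>
  yields the Jacobian times \<open>pd k f\<close> on one side and times \<open>pd k g\<close> on the
  other. The Jacobian cancels, and \<open>coeff_UNIV_eq\<close> concludes.\<close>

lemma berezin_elementary:
  fixes \<rho> :: "('k::comm_ring_1, 'n::{finite,linorder}) grassmann \<Rightarrow> ('k, 'n) grassmann"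
  assumes \<rho>: "near_id \<rho>" and fixed: "\<And>i. i \<noteq> k \<Longrightarrow> \<rho> (gen i) = gen i"
  shows "berezin \<rho>"
  unfolding berezin_def
proof (intro allI impI)
  fix f g assume fg: "\<rho> f = jacobian \<rho> * g"
  have J: "jacobian \<rho> = pd k (\<rho> (gen k))"
    by (rule jacobian_elementary) (rule fixed)
  have hom: "ghom \<rho>" using \<rho> by blast
  \<comment> \<open>For \<open>l \<noteq> k\<close> the factor \<open>pd k (gen l)\<close> is 0, and
    \<rho> fixes \<open>pd k f\<close>.\<close>
  have "pd k (\<rho> f) = (\<Sum>l\<in>UNIV. if l = k then jacobian \<rho> * pd k f else 0)"
    by (subst chain_rule[OF \<rho>], rule sum.cong) (auto simp: J fixed pd_gen ghom_fixes_pd[of \<rho>, OF hom fixed])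
  then have "pd k (\<rho> f) = jacobian \<rho> * pd k f" by simp
  \<comment> \<open>The Jacobian is itself a derivative by \<open>gen k\<close>, so
    \<open>pd_pd\<close> removes one summand of the product rule; as it is even, the other carries
    no sign.\<close>
  moreover have "pd k (\<rho> f) = jacobian \<rho> * pd k g"
    unfolding fg pd_mult parity_even[OF jacobian_even[OF \<rho>]] by (simp add: J pd_pd)
  ultimately have "jacobian \<rho> * pd k g = jacobian \<rho> * pd k f" by simp
  then have "\<rho> (jacobian (inv_into UNIV \<rho>)) * (jacobian \<rho> * pd k g) =
      \<rho> (jacobian (inv_into UNIV \<rho>)) * (jacobian \<rho> * pd k f)"
    by (rule arg_cong)
  then have "pd k g = pd k f"
    by (simp add: jacobian_inverse(2)[OF \<rho>] flip: mult.assoc)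
  then show "coeff UNIV g = coeff UNIV f"
    using coeff_UNIV_eq[of g k] coeff_UNIV_eq[of f k] by simp
qed

text \<open>The intermediate integrand is \<open>\<tau> f\<close> divided by the Jacobian of \<tau>;
  its integral equals that of \<open>f\<close> by the property of \<tau> and that of
  \<open>g\<close> by the property of \<sigma>.\<close>

lemma berezin_comp:
  fixes \<sigma> \<tau> :: "('k::comm_ring_1, 'n::{finite,linorder}) grassmann \<Rightarrow> ('k, 'n) grassmann"
  assumes \<sigma>: "near_id \<sigma>" "berezin \<sigma>" and \<tau>: "near_id \<tau>" "berezin \<tau>"
  shows "berezin (\<sigma> \<circ> \<tau>)"
  unfolding berezin_def
proof (intro allI impI)
  fix f g assume "(\<sigma> \<circ> \<tau>) f = jacobian (\<sigma> \<circ> \<tau>) * g"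
  then have fg: "\<sigma> (\<tau> f) = \<sigma> (jacobian \<tau>) * (jacobian \<sigma> * g)"
    by (simp add: jacobian_comp[OF \<sigma>(1) \<tau>(1)] even_components_commute[OF jacobian_even[OF \<sigma>(1)]] mult.assoc)
  have hom: "ghom \<sigma>" using \<sigma> by blast
  \<comment> \<open>This is the inverse of the Jacobian of \<tau>.\<close>
  define v where "v = \<tau> (jacobian (inv_into UNIV \<tau>))"
  have v: "v * jacobian \<tau> = 1" "jacobian \<tau> * v = 1"
    using jacobian_inverse(2)[OF \<tau>(1)] even_components_commute[OF jacobian_even[OF \<tau>(1)]]
    by (simp_all add: v_def)
  have "\<tau> f = jacobian \<tau> * (v * \<tau> f)"
    by (simp add: v flip: mult.assoc)
  then have "coeff UNIV (v * \<tau> f) = coeff UNIV f"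
    using \<tau>(2) unfolding berezin_def by blast
  moreover have "\<sigma> v * \<sigma> (jacobian \<tau>) = 1"
    by (simp add: v ghom_one[OF hom] flip: ghom_mult[OF hom])
  then have "\<sigma> (v * \<tau> f) = jacobian \<sigma> * g"
    by (simp add: ghom_mult[OF hom] fg flip: mult.assoc)
  then have "coeff UNIV g = coeff UNIV (v * \<tau> f)"
    using \<sigma>(2) unfolding berezin_def by blast
  ultimately show "coeff UNIV g = coeff UNIV f" by simp
qed

text \<open>Composing \<open>\<sigma>\<close> with the inverse of the elementary \<open>\<rho>\<close> that agrees with \<open>\<sigma>\<close> on one generator
  fixes that generator and every generator fixed by \<open>\<sigma>\<close>.\<close>

lemma berezin_near_id:
  fixes \<sigma> :: "('k::comm_ring_1, 'n::{finite,linorder}) grassmann \<Rightarrow> ('k, 'n) grassmann"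
  assumes "near_id \<sigma>"
  shows "berezin \<sigma>"
  using assms
proof (induction "card {i. \<sigma> (gen i) \<noteq> gen i}" arbitrary: \<sigma> rule: less_induct)
  case less
  note \<sigma> = less.prems
  show ?case
  proof (cases "\<exists>k. \<sigma> (gen k) \<noteq> gen k")
    case False
    then have "\<sigma> = id"
      using \<sigma> near_id_id by (intro ghom_eqI) auto
    then show ?thesis by (simp add: berezin_def jacobian_id)
  next
    case True
    then obtain k where k: "\<sigma> (gen k) \<noteq> gen k" by blast
    have "\<sigma> (gen k) - gen k \<in> components {d. odd d \<and> 3 \<le> d}"
      using \<sigma> by blast
    then obtain \<rho> where \<rho>: "near_id \<rho>" "\<rho> (gen k) = \<sigma> (gen k)" "\<forall>i. i \<noteq> k \<longrightarrow> \<rho> (gen i) = gen i"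
      using elementary_automorphism by blast
    let ?\<tau> = "inv_into UNIV \<rho> \<circ> \<sigma>"
    have inv: "inv_into UNIV \<rho> (\<rho> a) = a" for a
      using near_id_inv_comp(1)[OF \<rho>(1)] by (simp add: fun_eq_iff)
    have "?\<tau> (gen k) = gen k" using inv[of "gen k"] \<rho>(2) by simp
    moreover have "?\<tau> (gen i) = gen i" if "\<sigma> (gen i) = gen i" for i
      using inv[of "gen i"] \<rho>(3) that k by (cases "i = k") auto
    ultimately have "{i. ?\<tau> (gen i) \<noteq> gen i} \<subset> {i. \<sigma> (gen i) \<noteq> gen i}"
      using k by blast
    then have "card {i. ?\<tau> (gen i) \<noteq> gen i} < card {i. \<sigma> (gen i) \<noteq> gen i}"
      by (intro psubset_card_mono) auto
    moreover have \<tau>: "near_id ?\<tau>"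
      by (rule near_id_comp[OF near_id_inv[OF \<rho>(1)] \<sigma>])
    ultimately have "berezin (\<rho> \<circ> ?\<tau>)"
      using less.hyps berezin_comp[OF \<rho>(1) _ \<tau>] berezin_elementary[OF \<rho>(1), of k] \<rho>(3) by blast
    moreover have "\<rho> \<circ> ?\<tau> = \<sigma>"
      by (simp add: near_id_inv_comp(2)[OF \<rho>(1)] flip: comp_assoc)
    ultimately show ?thesis by simp
  qed
qed

text \<open>A Jacobian in this ascent is \<open>1 + z\<close> with \<open>z\<close> a multiple of
  the top monomial and has inverse \<open>1 - z\<close>, so the integral of \<open>1 - z\<close>
  must equal that of 1.\<close>

lemma Jacobian_ascent_card:
  "Jacobian_ascent (card (UNIV :: 'n set)) =
    (Jacobian_group :: (('k::comm_ring_1, 'n::{finite,linorder}) grassmann \<Rightarrow> ('k, 'n) grassmann) set)"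
proof (intro equalityI subsetI)
  let ?n = "card (UNIV :: 'n set)"
  fix \<sigma> :: "('k, 'n) grassmann \<Rightarrow> ('k, 'n) grassmann"
  assume "\<sigma> \<in> Jacobian_ascent ?n"
  then have \<sigma>: "near_id \<sigma>" and z: "jacobian \<sigma> - 1 \<in> components (ascent_degrees ?n)"
    by (simp_all only: Jacobian_ascent_iff simp_thms)
  let ?z = "jacobian \<sigma> - 1"
  \<comment> \<open>One factor has degree at least 2 and the other at least \<open>?n\<close>, so
    the product lies beyond the top degree.\<close>
  have "?z * ?z \<in> components {?n<..}"
    by (rule components_mult[OF z z]) auto
  then have "?z * ?z = 0" by (rule components_above_card)
  \<comment> \<open>This is the premise of \<open>berezin\<close> for \<open>f = 1\<close> and
    \<open>g = 1 - ?z\<close>.\<close>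
  then have "\<sigma> 1 = jacobian \<sigma> * (1 - ?z)"
    using \<sigma> by (simp add: ghom_one left_diff_distrib right_diff_distrib)
  then have "coeff UNIV (1 - ?z) = coeff UNIV (1 :: ('k, 'n) grassmann)"
    using berezin_near_id[OF \<sigma>] unfolding berezin_def by blast
  then have top: "coeff UNIV ?z = 0"
    by (simp only: coeff_diff) simp
  have "coeff S ?z = 0" for S
  proof (rule ccontr)
    assume "coeff S ?z \<noteq> 0"
    then have "?n \<le> card S"
      using z unfolding components_eq_coeff by blast
    then have "S = UNIV"
      by (intro card_seteq) auto
    with top \<open>coeff S ?z \<noteq> 0\<close> show False by simp
  qed
  then have "?z = 0"
    using monomial_expansion[of ?z] by simp
  with \<sigma> show "\<sigma> \<in> Jacobian_group"
    by (simp add: Jacobian_group_def Gamma_eq)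
next
  fix \<sigma> :: "('k, 'n) grassmann \<Rightarrow> ('k, 'n) grassmann"
  assume "\<sigma> \<in> Jacobian_group"
  then show "\<sigma> \<in> Jacobian_ascent (card (UNIV :: 'n set))"
    by (simp add: Jacobian_group_def Gamma_eq Jacobian_ascent_iff)
qed

theorem corollary7p7:
  fixes n :: nat
    and G :: "(('k::comm_ring_1, 'n::{finite,linorder}) grassmann \<Rightarrow> ('k, 'n) grassmann) monoid"
    and \<Gamma> :: "nat \<Rightarrow> (('k, 'n) grassmann \<Rightarrow> ('k, 'n) grassmann) set"
    and \<Sigma> :: "(('k, 'n) grassmann \<Rightarrow> ('k, 'n) grassmann) set"
  defines "n \<equiv> card (UNIV :: 'n set)"
    and "G \<equiv> Gamma_group"
    and "\<Gamma> \<equiv> Jacobian_ascent"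
    and "\<Sigma> \<equiv> Jacobian_group"
  assumes "n \<ge> 4"
  shows "group G \<and> (\<forall>m \<in> {1..n div 2 + 1}. subgroup (\<Gamma> (2 * m)) G) \<and>
    (odd n \<longrightarrow>
      carrier G = \<Gamma> 2 \<and>
      (\<forall>m \<in> {1..n div 2}. \<Gamma> (2 * m + 2) \<subset> \<Gamma> (2 * m)) \<and>
      \<Gamma> (2 * (n div 2) + 2) = \<Sigma>) \<and>
    (even n \<longrightarrow>
      carrier G = \<Gamma> 2 \<and>
      (\<forall>m. 1 \<le> m \<and> m < n div 2 \<longrightarrow> \<Gamma> (2 * m + 2) \<subset> \<Gamma> (2 * m)) \<and>
      \<Gamma> (2 * (n div 2)) = \<Gamma> (2 * (n div 2) + 2) \<and>
      \<Gamma> (2 * (n div 2) + 2) = \<Sigma>)"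
proof -
  have G: "carrier G = \<Gamma> 2"
    by (simp add: G_def \<Gamma>_def Gamma_group_def Jacobian_ascent_2)
  have strict: "\<Gamma> (2 * m + 2) \<subset> \<Gamma> (2 * m)" if "1 \<le> m" "2 * m < n" for m
    using that unfolding \<Gamma>_def n_def by (rule Jacobian_ascent_strict)
  have above: "\<Gamma> k = \<Sigma>" if "n < k" for k
    using that unfolding \<Gamma>_def \<Sigma>_def n_def by (rule Jacobian_ascent_above_card)
  have top: "\<Gamma> n = \<Sigma>"
    unfolding \<Gamma>_def \<Sigma>_def n_def by (rule Jacobian_ascent_card)
  have "group G" and "subgroup (\<Gamma> k) G" for k
    unfolding G_def \<Gamma>_def by (rule group_Gamma_group subgroup_Jacobian_ascent)+
  \<comment> \<open>For odd \<open>n\<close> the step \<open>m = n div 2\<close> is still strict,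
    since \<open>2 * (n div 2) = n - 1\<close>.\<close>
  moreover have "2 * m < n" if "odd n" "m \<le> n div 2" for m
    using that by (elim oddE) simp
  moreover have "2 * m < n" if "m < n div 2" for m
    using that by simp
  moreover have "n < 2 * (n div 2) + 2"
    by simp
  \<comment> \<open>For even \<open>n\<close> the last two ascents therefore both equal \<Sigma>,
    one by \<open>top\<close> and the other by \<open>above\<close>.\<close>
  moreover have "2 * (n div 2) = n" if "even n"
    using that by simp
  ultimately show ?thesis
    using G strict above top by auto
qed

end
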